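(* Let $\alpha(\theta)$ be a real-valued function of $\theta>0$ satisfying either $\lim_{\theta\to\infty}\frac{\alpha(\theta)}{\theta}=0$ or $\lim_{\theta\to\infty}\frac{\alpha(\theta)}{\theta}=c$ for some $c>0$. Let $H\in C_b(\bar\nabla)$ and define the probability measure $\Xi^H_{\alpha,\theta}$ on $\bar\nabla$ by $$\Xi^H_{\alpha,\theta}(d\mathbf{p})=\frac{e^{\alpha(\theta)H(\mathbf{p})}}{E^{\Xi_\theta}[e^{\alpha(\theta)H(\mathbf{q})}]}\,\Xi_\theta(d\mathbf{p}).$$ Then the family $\{\Xi^H_{\alpha,\theta}\}$ satisfies a large deviation principle on $\bar\nabla$ (as $\theta\to\infty$) with speed $\theta$ and rate function $$S_\alpha(\mathbf{p})=\begin{cases}S(\mathbf{p}), & \text{if }\lim_{\theta\to\infty}\frac{\alpha(\theta)}{\theta}=0,\\ S^c(\mathbf{p}), & \text{if }\lim_{\theta\to\infty}\frac{\alpha(\theta)}{\theta}=c>0,\end{cases}$$ where $$S^c(\mathbf{p})=\sup_{\mathbf{q}\in\bar\nabla}\{cH(\mathbf{q})-S(\mathbf{q})\}-(cH(\mathbf{p})-S(\mathbf{p})).$$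
   Context: **Large deviation principle (LDP).** Let $E$ be a complete separable metric space. A family $\{Q_\theta:\theta>0\}$ of probability measures on $E$ satisfies an LDP (as $\theta\to\infty$) with speed $\theta$ and rate function $I:E\to[0,\infty]$ if for every closed $F\subset E$ and every open $G\subset E$, $\limsup_{\theta\to\infty}\frac1\theta\log Q_\theta\{F\}\le-\inf_{x\in F}I(x)$ and $\liminf_{\theta\to\infty}\frac1\theta\log Q_\theta\{G\}\ge-\inf_{x\in G}I(x)$, and for every $c>0$ the set $\{x:I(x)\le c\}$ is compact. (Conventions: $\log 0=-\infty$, $\inf\emptyset=\infty$.) **The Poisson–Dirichlet distribution.** For $\theta>0$, let $U_1,U_2,\ldots$ be i.i.d. with $Beta(1,\theta)$ distribution (density $\theta(1-x)^{\theta-1}$ on $(0,1)$). Put $X_1=U_1$ and $X_k=(1-U_1)\cdots(1-U_{k-1})U_k$ for $k\ge2$. Let $P_k(\theta)$ be the $k$th largest among $X_1,X_2,\ldots$, i.e. $\mathbf{P}(\theta)=(P_1(\theta),P_2(\theta),\ldots)$ is the sequence $(X_k)$ rearranged in descending order. The law of $\mathbf{P}(\theta)$ is the Poisson–Dirichlet distribution $PD(\theta)$. **State space.** $\bar\nabla=\{(p_1,p_2,\ldots):p_1\ge p_2\ge\cdots\ge0,\ \sum_{k=1}^\infty p_k\le1\}$, with the subspace topology inherited from the product topology of $\mathbb{R}^\infty$; it is metrized by $d(\mathbf{p},\mathbf{q})=\sum_{k=1}^\infty|p_k-q_k|/2^k$. $\Xi_\theta$ denotes the law of $\mathbf{P}(\theta)$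 on $\bar\nabla$, $E^{\Xi_\theta}$ is expectation under $\Xi_\theta$, and $C_b(\bar\nabla)$ is the set of bounded continuous real functions on $\bar\nabla$. **The function $S$.** For $\mathbf{p}\in\bar\nabla$, $S(\mathbf{p})=\log\frac1{1-\sum_{k=1}^\infty p_k}$ if $\sum_{k=1}^\infty p_k<1$, and $S(\mathbf{p})=\infty$ otherwise. (When $S(\mathbf{p})=\infty$, $S^c(\mathbf{p})=\infty$.) *)

theory Defs
  imports "HOL-Probability.Probability"
begin

section \<open>Large deviation principles\<close>

text \<open>The value of \<open>log 0\<close> has to be set explicitly, since \<^term>\<open>ln (0::real)\<close> is a real number.\<close>

definition ereal_log :: "real \<Rightarrow> ereal" where
  "ereal_log x = (if x = 0 then - \<infinity> else ereal (ln x))"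

text \<open>
  Large deviation principle on the subspace \<open>E\<close> of a Polish space, as \<open>\<theta> \<rightarrow> \<infinity>\<close>, with speed \<open>\<theta>\<close>.
  Closed and open sets are relative to \<open>E\<close>. The infimum over the empty set is \<open>\<infinity>\<close> in
  \<^typ>\<open>ereal\<close>. The clause on \<open>Q\<close> says that it is a family of Borel probability measures on \<open>E\<close>.
\<close>

definition LDP :: "'a::polish_space set \<Rightarrow> (real \<Rightarrow> 'a measure) \<Rightarrow> ('a \<Rightarrow> ereal) \<Rightarrow> bool" where
  "LDP E Q I \<longleftrightarrow>
     (\<forall>\<theta>>0. prob_space (Q \<theta>) \<and> sets (Q \<theta>) = sets (restrict_space borel E)) \<and>
     (\<forall>x\<in>E. 0 \<le> I x) \<and>
     (\<forall>F. closedin (top_of_set E) F \<longrightarrow>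
        Limsup at_top (\<lambda>\<theta>. ereal (1 / \<theta>) * ereal_log (measure (Q \<theta>) F)) \<le> - (INF x\<in>F. I x)) \<and>
     (\<forall>G. openin (top_of_set E) G \<longrightarrow>
        Liminf at_top (\<lambda>\<theta>. ereal (1 / \<theta>) * ereal_log (measure (Q \<theta>) G)) \<ge> - (INF x\<in>G. I x)) \<and>
     (\<forall>c::real. c > 0 \<longrightarrow> compact {x\<in>E. I x \<le> ereal c})"

section \<open>The Poisson--Dirichlet distribution\<close>

text \<open>
  Sequences are indexed from \<open>0\<close>: the entry \<open>p\<^sub>k\<close> of the usual notation is \<open>p (k - 1)\<close>. The type
  \<^typ>\<open>nat \<Rightarrow> real\<close> carries the product topology and the Borel sigma-algebra generated by it.
\<close>

definition nabla_bar :: "(nat \<Rightarrow> real) set" where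
  "nabla_bar = {p. decseq p \<and> (\<forall>k. 0 \<le> p k) \<and> summable p \<and> (\<Sum>k. p k) \<le> 1}"

text \<open>
  \<open>Beta(1, \<theta>)\<close>, as a measure whose space is the open interval \<open>(0, 1)\<close>. Hence every point of the
  product space underlying \<open>PD\<close> below is a sequence in \<open>(0, 1)\<close>, for which the stick-breaking
  sequence is positive and tends to \<open>0\<close>; so its descending rearrangement always exists and no
  exceptional null set has to be treated.
\<close>

definition beta_one :: "real \<Rightarrow> real measure" where
  "beta_one \<theta> = density (restrict_space lborel {0<..<1}) (\<lambda>x. ennreal (\<theta> * (1 - x) powr (\<theta> - 1)))"

definition stick_breaking :: "(nat \<Rightarrow> real) \<Rightarrow> nat \<Rightarrow> real" where
  "stick_breaking u k = (\<Prod>i<k. 1 - u i) * u k"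

text \<open>A descending rearrangement is unique whenever it exists, also for repeated entries.\<close>

definition descending_rearrangement :: "(nat \<Rightarrow> real) \<Rightarrow> nat \<Rightarrow> real" where
  "descending_rearrangement x = (THE q. decseq q \<and> (\<exists>\<sigma>. bij \<sigma> \<and> q = x \<circ> \<sigma>))"

definition PD :: "real \<Rightarrow> (nat \<Rightarrow> real) measure" where
  "PD \<theta> = distr (\<Pi>\<^sub>M i\<in>(UNIV::nat set). beta_one \<theta>) (restrict_space borel nabla_bar)
             (\<lambda>u. descending_rearrangement (stick_breaking u))"

section \<open>The tilted measures and the rate functions\<close>

definition tilted_PD :: "(real \<Rightarrow> real) \<Rightarrow> ((nat \<Rightarrow> real) \<Rightarrow> real) \<Rightarrow> real \<Rightarrow> (nat \<Rightarrow> real) measure" where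
  "tilted_PD \<alpha> H \<theta> = density (PD \<theta>)
     (\<lambda>p. ennreal (exp (\<alpha> \<theta> * H p) / (\<integral>q. exp (\<alpha> \<theta> * H q) \<partial>PD \<theta>)))"

definition rate_S :: "(nat \<Rightarrow> real) \<Rightarrow> ereal" where
  "rate_S p = (if (\<Sum>k. p k) < 1 then ereal (ln (1 / (1 - (\<Sum>k. p k)))) else \<infinity>)"

text \<open>
  For bounded \<open>H\<close> the supremum is a real number, so extended real arithmetic gives
  \<open>rate_Sc c H p = \<infinity>\<close> whenever \<open>rate_S p = \<infinity>\<close>.
\<close>

definition rate_Sc :: "real \<Rightarrow> ((nat \<Rightarrow> real) \<Rightarrow> real) \<Rightarrow> (nat \<Rightarrow> real) \<Rightarrow> ereal" where
  "rate_Sc c H p =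
     (SUP q\<in>nabla_bar. ereal (c * H q) - rate_S q) - (ereal (c * H p) - rate_S p)"

end

theory Submission
  imports Defs "HOL-Real_Asymp.Real_Asymp"
begin

text \<open>
  Everything takes place on a compact space: \<^term>\<open>nabla_bar\<close> is a closed subset of \<open>[0,1]\<^sup>\<nat>\<close>.
  On a compact space a large deviation principle is a local matter. It suffices to know that small
  neighbourhoods of a point \<open>p\<close> have probability about \<open>exp (- \<theta> I p)\<close> on the exponential scale
  (\<open>local_rate\<close>): closed sets are covered by finitely many neighbourhoods, open sets contain one,
  and both nonnegativity and lower semicontinuity of \<open>I\<close> are forced by the two local estimates. In this form
  tilting is transparent as well. On a small neighbourhood of \<open>p\<close> the weight \<open>exp (\<alpha>(\<theta>) H)\<close> is
  \<open>exp (\<theta> (h H p \<plusminus> \<eta>))\<close> with \<open>h = lim \<alpha>(\<theta>)/\<theta>\<close>, so the rate becomes \<open>S - h H\<close>, and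
  normalising subtracts the infimum of this function. The case \<open>h = 0\<close> returns \<open>S\<close>, because \<open>S \<ge> 0\<close>
  vanishes at the zero sequence.

  This reduces the theorem to the local rate \<open>S\<close> of \<open>PD(\<theta>)\<close>. Let \<open>X\<^sub>i\<close> be the stick-breaking
  pieces made from the beta fractions \<open>U\<^sub>i\<close>, let \<open>P\<^sub>k\<close> be the same pieces in descending order, and
  \<open>V\<^sub>i = 1 - U\<^sub>i\<close>, so that \<open>E V\<^sub>i\<^sup>a = \<theta>/(\<theta>+a)\<close> for \<open>a > - \<theta>\<close>.

  Upper bound. A suitable neighbourhood of \<open>p\<close> is given by \<open>\<Sum>k<n. P\<^sub>k > t\<close> with \<open>t\<close> slightly below
  \<open>\<Sum>k. p\<^sub>k\<close>. The \<open>n\<close> largest entries are \<open>X\<^sub>i\<close> for \<open>i\<close> in some set \<open>B\<close> of \<open>n\<close> indices, and always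
  \<open>\<Sum>i\<in>B. X\<^sub>i \<le> 1 - \<Prod>i\<in>B. V\<^sub>i\<close>. For fixed \<open>B\<close>, Markov's inequality with the moment of order
  \<open>1 - \<theta>\<close> gives \<open>P (\<Prod>i\<in>B. V\<^sub>i < y) \<le> \<theta>\<^sup>n y\<^bsup>\<theta>-1\<^esup>\<close>. Only indices up to about \<open>\<theta>\<^sup>3\<close> matter, since the mass
  \<open>\<Prod>i<N. V\<^sub>i\<close> that is left after \<open>N\<close> breaks is super-exponentially unlikely to exceed a constant.
  So the union over \<open>B\<close> costs a polynomial factor only (\<open>top_sum_prob_le\<close>).

  Lower bound. Make the first \<open>n\<close> stick-breaking pieces close to \<open>p\<^sub>0, \<dots>, p\<^bsub>n-1\<^esub>\<close>, in this order. This
  costs about \<open>(\<Prod>k<n. 1 - w\<^sub>k)\<^sup>\<theta> = (1 - \<Sum>k<n. p\<^sub>k)\<^sup>\<theta>\<close>, where \<open>w\<^sub>k\<close> are the fractions that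
  produce these pieces. Independently of this, all later pieces are small with probability tending to
  \<open>1\<close>, by a second moment bound (\<open>box_prob_ge\<close>), and then sorting does not disturb the first
  \<open>n\<close> entries (\<open>ranked_near\<close>).
\<close>

section \<open>Large deviations on a compact space from local rates\<close>

text \<open>
  The family of set functions \<open>m \<theta>\<close> is arbitrary, so that the notion also applies to unnormalised
  measures and to quotients of measures.
\<close>
definition local_rate ::
  "'a::polish_space set \<Rightarrow> (real \<Rightarrow> 'a set \<Rightarrow> real) \<Rightarrow> ('a \<Rightarrow> ereal) \<Rightarrow> bool" where
  "local_rate E m I \<longleftrightarrow>
     (\<forall>p\<in>E. \<forall>a. ereal a < I p \<longrightarrow>
        (\<exists>V. open V \<and> p \<in> V \<and> (\<forall>\<^sub>F \<theta> in at_top. m \<theta> (V \<inter> E) \<le> exp (- (a * \<theta>))))) \<and>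
     (\<forall>p\<in>E. \<forall>a V. I p < ereal a \<longrightarrow> open V \<longrightarrow> p \<in> V \<longrightarrow>
        (\<forall>\<^sub>F \<theta> in at_top. exp (- (a * \<theta>)) \<le> m \<theta> (V \<inter> E)))"

lemma local_rate_upperE:
  assumes "local_rate E m I" "p \<in> E" "ereal a < I p"
  obtains V where "open V" "p \<in> V" "\<forall>\<^sub>F \<theta> in at_top. m \<theta> (V \<inter> E) \<le> exp (- (a * \<theta>))"
  using assms unfolding local_rate_def by blast

lemma local_rate_lowerD:
  assumes "local_rate E m I" "p \<in> E" "I p < ereal a" "open V" "p \<in> V"
  shows "\<forall>\<^sub>F \<theta> in at_top. exp (- (a * \<theta>)) \<le> m \<theta> (V \<inter> E)"
  using assms unfolding local_rate_def by blast

lemma eventually_const_mult_exp_le: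
  fixes a b C :: real
  assumes "a < b"
  shows "\<forall>\<^sub>F \<theta> in at_top. C * exp (- (b * \<theta>)) \<le> exp (- (a * \<theta>))"
proof -
  have "((\<lambda>\<theta>. C * exp (- ((b - a) * \<theta>))) \<longlongrightarrow> 0) at_top"
    using assms by real_asymp
  then have "\<forall>\<^sub>F \<theta> in at_top. C * exp (- ((b - a) * \<theta>)) < 1"
    by (rule order_tendstoD) simp
  then show ?thesis
  proof eventually_elim
    case (elim \<theta>)
    have "C * exp (- (b * \<theta>)) = (C * exp (- ((b - a) * \<theta>))) * exp (- (a * \<theta>))"
      by (simp add: algebra_simps flip: exp_add)
    also have "\<dots> \<le> 1 * exp (- (a * \<theta>))"
      using elim by (intro mult_right_mono) auto
    finally show ?case by simp
  qed
qed

lemma sets_restrict_open_Int: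
  assumes "sets M = sets (restrict_space borel E)" "open V"
  shows "V \<inter> E \<in> sets M"
  using assms by (auto simp: sets_restrict_space)

text \<open>
  The finitely many sets of a subcover contribute a constant factor, which any loss in the
  exponential rate absorbs.
\<close>
lemma eventually_measure_compact_le:
  fixes K :: "real \<Rightarrow> 'a::polish_space measure"
  assumes K: "\<And>\<theta>. \<theta> > 0 \<Longrightarrow> finite_measure (K \<theta>)"
      "\<And>\<theta>. \<theta> > 0 \<Longrightarrow> sets (K \<theta>) = sets (restrict_space borel E)"
    and F: "compact F" "F \<subseteq> E"
    and local: "\<And>p. p \<in> F \<Longrightarrow> \<exists>V. open V \<and> p \<in> V \<and>
      (\<forall>\<^sub>F \<theta> in at_top. measure (K \<theta>) (V \<inter> E) \<le> exp (- (b * \<theta>)))"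
    and "a < b"
  shows "\<forall>\<^sub>F \<theta> in at_top. measure (K \<theta>) F \<le> exp (- (a * \<theta>))"
proof -
  obtain V where V: "\<And>p. p \<in> F \<Longrightarrow> open (V p) \<and> p \<in> V p \<and>
      (\<forall>\<^sub>F \<theta> in at_top. measure (K \<theta>) (V p \<inter> E) \<le> exp (- (b * \<theta>)))"
    using local by metis
  obtain C where C: "C \<subseteq> F" "finite C" "F \<subseteq> (\<Union>p\<in>C. V p)"
    using compactE_image[OF F(1), of F V] V by blast
  have "\<forall>\<^sub>F \<theta> in at_top. \<forall>p\<in>C. measure (K \<theta>) (V p \<inter> E) \<le> exp (- (b * \<theta>))"
    using C V by (intro eventually_ball_finite) auto
  moreover have "\<forall>\<^sub>F \<theta> in at_top. real (card C) * exp (- (b * \<theta>)) \<le> exp (- (a * \<theta>))"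
    by (rule eventually_const_mult_exp_le[OF \<open>a < b\<close>])
  moreover have "\<forall>\<^sub>F \<theta> in at_top. (\<theta>::real) > 0"
    by (rule eventually_gt_at_top)
  ultimately show ?thesis
  proof eventually_elim
    case (elim \<theta>)
    interpret finite_measure "K \<theta>" using K elim by auto
    have ms: "V p \<inter> E \<in> sets (K \<theta>)" if "p \<in> C" for p
      using K(2) elim V C that by (intro sets_restrict_open_Int) auto
    have "measure (K \<theta>) F \<le> measure (K \<theta>) (\<Union>p\<in>C. V p \<inter> E)"
      using C F ms by (intro finite_measure_mono sets.finite_UN) auto
    also have "\<dots> \<le> (\<Sum>p\<in>C. measure (K \<theta>) (V p \<inter> E))"
      using C ms by (intro finite_measure_subadditive_finite) auto
    also have "\<dots> \<le> (\<Sum>p\<in>C. exp (- (b * \<theta>)))"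
      using elim by (intro sum_mono) auto
    also have "\<dots> \<le> exp (- (a * \<theta>))"
      using elim by simp
    finally show ?case .
  qed
qed

lemma scaled_log_le_iff:
  assumes "\<theta> > 0" "m \<ge> 0"
  shows "ereal (1 / \<theta>) * ereal_log m \<le> ereal (- a) \<longleftrightarrow> m \<le> exp (- (a * \<theta>))"
proof (cases "m = 0")
  case False
  then have "m > 0" using assms by simp
  have "ln m / \<theta> \<le> - a \<longleftrightarrow> ln m \<le> - (a * \<theta>)"
    using assms by (simp add: divide_simps)
  then show ?thesis
    using \<open>m > 0\<close> ln_le_cancel_iff[of m "exp (- (a * \<theta>))"] by (simp add: ereal_log_def)
qed (use assms in \<open>auto simp: ereal_log_def\<close>)

lemma scaled_log_ge_iff:
  assumes "\<theta> > 0" "m \<ge> 0"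
  shows "ereal (- a) \<le> ereal (1 / \<theta>) * ereal_log m \<longleftrightarrow> exp (- (a * \<theta>)) \<le> m"
proof (cases "m = 0")
  case False
  then have "m > 0" using assms by simp
  have "- a \<le> ln m / \<theta> \<longleftrightarrow> - (a * \<theta>) \<le> ln m"
    using assms by (simp add: divide_simps)
  then show ?thesis
    using \<open>m > 0\<close> by (simp add: ereal_log_def ln_ge_iff)
qed (use assms in \<open>auto simp: ereal_log_def\<close>)

text \<open>
  A negative rate would force probabilities above \<open>1\<close>.
\<close>
lemma local_rate_nonneg:
  assumes "\<And>\<theta>. \<theta> > 0 \<Longrightarrow> prob_space (Q \<theta>)"
    and rate: "local_rate E (\<lambda>\<theta>. measure (Q \<theta>)) I" and "p \<in> E"
  shows "0 \<le> I p"
proof (rule ccontr)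
  assume "\<not> 0 \<le> I p"
  then have "I p < ereal 0" by (simp add: zero_ereal_def)
  then obtain a where a: "I p < ereal a" "a < 0"
    by (metis ereal_dense2 ereal_less(2) ereal_less_eq(3) less_ereal.simps(1))
  have "\<forall>\<^sub>F \<theta> in at_top. exp (- (a * \<theta>)) \<le> measure (Q \<theta>) (UNIV \<inter> E)"
    by (rule local_rate_lowerD[OF rate \<open>p \<in> E\<close> a(1)]) auto
  moreover have "\<forall>\<^sub>F \<theta> in at_top. (\<theta>::real) > 0"
    by (rule eventually_gt_at_top)
  ultimately have "\<forall>\<^sub>F \<theta> in at_top. \<theta> > 0 \<and> exp (- (a * \<theta>)) \<le> measure (Q \<theta>) (UNIV \<inter> E)"
    by eventually_elim auto
  then obtain \<theta> where \<theta>: "\<theta> > 0" "exp (- (a * \<theta>)) \<le> measure (Q \<theta>) (UNIV \<inter> E)"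
    using eventually_happens trivial_limit_at_top_linorder by blast
  have "measure (Q \<theta>) (UNIV \<inter> E) \<le> 1"
    using assms(1) \<theta>(1) by (simp add: prob_space.prob_le_1)
  moreover have "1 < exp (- (a * \<theta>))"
    using a \<theta> by (simp add: mult_neg_pos)
  ultimately show False using \<theta>(2) by linarith
qed

text \<open>
  The local bounds imply that \<open>I\<close> is lower semicontinuous: a neighbourhood witnessing
  \<open>I p > a\<close> cannot contain a point of smaller rate, because the lower bound at that point would
  contradict the upper bound for the neighbourhood.
\<close>
lemma local_rate_level_compact:
  assumes "compact E" and rate: "local_rate E m I"
  shows "compact {x\<in>E. I x \<le> ereal c}"
proof -
  have "\<exists>V. open V \<and> p \<in> V \<and> (\<forall>q\<in>V \<inter> E. ereal c < I q)" if "p \<in> E" "ereal c < I p" for p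
  proof -
    obtain a where a: "ereal c < ereal a" "ereal a < I p"
      using ereal_dense2[OF \<open>ereal c < I p\<close>] by auto
    obtain b where b: "c < b" "b < a" using a(1) dense by auto
    obtain V where V: "open V" "p \<in> V" "\<forall>\<^sub>F \<theta> in at_top. m \<theta> (V \<inter> E) \<le> exp (- (a * \<theta>))"
      using local_rate_upperE[OF rate \<open>p \<in> E\<close> a(2)] .
    have "ereal c < I q" if q: "q \<in> V \<inter> E" for q
    proof (rule ccontr)
      assume "\<not> ereal c < I q"
      then have "I q < ereal b" using b by (meson ereal_less_eq(3) le_less_trans less_ereal.simps(1) not_less)
      then have "\<forall>\<^sub>F \<theta> in at_top. exp (- (b * \<theta>)) \<le> m \<theta> (V \<inter> E)"
        using local_rate_lowerD[OF rate] q V by auto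
      then have "\<forall>\<^sub>F \<theta>::real in at_top. False"
        using V(3) eventually_gt_at_top[of 0]
      proof eventually_elim
        case (elim \<theta>)
        then have "b * \<theta> \<ge> a * \<theta>" using exp_le_cancel_iff order_trans by fastforce
        then show ?case using elim b by simp
      qed
      then show False by simp
    qed
    then show ?thesis using V by blast
  qed
  then obtain V where V: "\<And>p. p \<in> E \<Longrightarrow> ereal c < I p \<Longrightarrow>
      open (V p) \<and> p \<in> V p \<and> (\<forall>q\<in>V p \<inter> E. ereal c < I q)"
    by metis
  have "{x\<in>E. I x \<le> ereal c} = E - (\<Union>p\<in>{p\<in>E. ereal c < I p}. V p)"
    using V by (auto simp: not_le[symmetric]) 
  moreover have "open (\<Union>p\<in>{p\<in>E. ereal c < I p}. V p)"
    using V by auto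
  ultimately show ?thesis
    using \<open>compact E\<close> by (simp add: compact_diff)
qed

text \<open>
  A relatively closed set is compact and hence covered by finitely many neighbourhoods on which the
  local upper bound holds; a relatively open set is a neighbourhood of each of its points.
\<close>
theorem LDP_if_local_rate:
  assumes "compact E"
    and Q: "\<And>\<theta>. \<theta> > 0 \<Longrightarrow> prob_space (Q \<theta>)"
      "\<And>\<theta>. \<theta> > 0 \<Longrightarrow> sets (Q \<theta>) = sets (restrict_space borel E)"
    and rate: "local_rate E (\<lambda>\<theta>. measure (Q \<theta>)) I"
  shows "LDP E Q I"
  unfolding LDP_def
proof (intro conjI allI impI ballI)
  fix F assume F: "closedin (top_of_set E) F"
  let ?L = "\<lambda>\<theta>. ereal (1 / \<theta>) * ereal_log (measure (Q \<theta>) F)"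
  have "compact F" "F \<subseteq> E"
    using F \<open>compact E\<close> closedin_compact closedin_imp_subset by blast+
  have "(INF x\<in>F. I x) \<le> - Limsup at_top ?L"
  proof (rule dense_le)
    fix y assume y: "y < (INF x\<in>F. I x)"
    show "y \<le> - Limsup at_top ?L"
    proof (cases y)
      case (real a)
      obtain b where b: "ereal a < ereal b" "ereal b < (INF x\<in>F. I x)"
        using ereal_dense2 y real by blast
      have "\<forall>\<^sub>F \<theta> in at_top. measure (Q \<theta>) F \<le> exp (- (a * \<theta>))"
      proof (rule eventually_measure_compact_le[where K = Q and E = E and b = b])
        show "\<exists>V. open V \<and> p \<in> V \<and> (\<forall>\<^sub>F \<theta> in at_top. measure (Q \<theta>) (V \<inter> E) \<le> exp (- (b * \<theta>)))"
          if "p \<in> F" for p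
        proof -
          have "ereal b < I p" using b(2) that by (meson INF_lower less_le_trans)
          then show ?thesis using local_rate_upperE[OF rate] that \<open>F \<subseteq> E\<close> by (metis subsetD)
        qed
      qed (use Q b \<open>compact F\<close> \<open>F \<subseteq> E\<close> in \<open>auto intro: prob_space.finite_measure\<close>)
      then have "\<forall>\<^sub>F \<theta> in at_top. ?L \<theta> \<le> ereal (- a)"
        using eventually_gt_at_top[of 0]
        by eventually_elim (subst scaled_log_le_iff, auto)
      then have "Limsup at_top ?L \<le> ereal (- a)"
        by (rule Limsup_bounded)
      then have "- ereal (- a) \<le> - Limsup at_top ?L" by (simp only: ereal_minus_le_minus)
      then show ?thesis by (simp add: real)
    next
      case PInf then show ?thesis using y by simp
    qed simp
  qed
  then show "Limsup at_top ?L \<le> - (INF x\<in>F. I x)"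
    by (metis ereal_minus_le_minus ereal_uminus_uminus)
next
  fix G assume G: "openin (top_of_set E) G"
  let ?L = "\<lambda>\<theta>. ereal (1 / \<theta>) * ereal_log (measure (Q \<theta>) G)"
  obtain V where V: "open V" "G = V \<inter> E"
    using G by (auto simp: openin_open)
  have "- Liminf at_top ?L \<le> I p" if "p \<in> G" for p
  proof (rule dense_ge)
    fix y assume y: "I p < y"
    show "- Liminf at_top ?L \<le> y"
    proof (cases y)
      case (real a)
      have "\<forall>\<^sub>F \<theta> in at_top. exp (- (a * \<theta>)) \<le> measure (Q \<theta>) G"
        unfolding V(2) using y real that V
        by (intro local_rate_lowerD[OF rate, of p]) auto
      then have "\<forall>\<^sub>F \<theta> in at_top. ereal (- a) \<le> ?L \<theta>"
        using eventually_gt_at_top[of 0]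
        by eventually_elim (subst scaled_log_ge_iff, auto)
      then have "ereal (- a) \<le> Liminf at_top ?L"
        by (rule Liminf_bounded)
      then have "- Liminf at_top ?L \<le> - ereal (- a)" by (simp only: ereal_minus_le_minus)
      then show ?thesis by (simp add: real)
    next
      case MInf then show ?thesis using y by simp
    qed simp
  qed
  then have "- Liminf at_top ?L \<le> (INF x\<in>G. I x)"
    by (rule INF_greatest)
  then show "- (INF x\<in>G. I x) \<le> Liminf at_top ?L"
    by (metis ereal_minus_le_minus ereal_uminus_uminus)
qed (use Q local_rate_nonneg[OF Q(1) rate] local_rate_level_compact[OF \<open>compact E\<close> rate] in auto)

section \<open>Exponential tilting\<close>

lemma density_exp_measure_bounds:
  assumes "finite_measure Q" and g: "g \<in> borel_measurable Q" and A: "A \<in> sets Q"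
  shows "(\<And>q. q \<in> A \<Longrightarrow> g q \<le> x) \<Longrightarrow>
      measure (density Q (\<lambda>q. ennreal (exp (g q)))) A \<le> exp x * measure Q A"
    and "(\<And>q. q \<in> A \<Longrightarrow> x \<le> g q) \<Longrightarrow> finite_measure (density Q (\<lambda>q. ennreal (exp (g q)))) \<Longrightarrow>
      exp x * measure Q A \<le> measure (density Q (\<lambda>q. ennreal (exp (g q)))) A"
proof -
  interpret finite_measure Q by fact
  let ?K = "density Q (\<lambda>q. ennreal (exp (g q)))"
  have eK: "emeasure ?K A = (\<integral>\<^sup>+q. ennreal (exp (g q)) * indicator A q \<partial>Q)"
    using g A by (subst emeasure_density) auto
  have eQ: "(\<integral>\<^sup>+q. ennreal (exp x) * indicator A q \<partial>Q) = ennreal (exp x * measure Q A)"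
    using A by (simp add: nn_integral_cmult_indicator emeasure_eq_measure ennreal_mult)
  show "measure ?K A \<le> exp x * measure Q A" if "\<And>q. q \<in> A \<Longrightarrow> g q \<le> x"
  proof -
    have "emeasure ?K A \<le> ennreal (exp x * measure Q A)"
      unfolding eK eQ[symmetric] using that
      by (intro nn_integral_mono) (auto split: split_indicator intro!: ennreal_leI)
    then show ?thesis
      unfolding measure_def by (metis enn2real_leI exp_ge_zero measure_def measure_nonneg mult_nonneg_nonneg)
  qed
  show "exp x * measure Q A \<le> measure ?K A"
    if "\<And>q. q \<in> A \<Longrightarrow> x \<le> g q" "finite_measure ?K"
  proof -
    have "ennreal (exp x * measure Q A) \<le> emeasure ?K A"
      unfolding eK eQ[symmetric] using that
      by (intro nn_integral_mono) (auto split: split_indicator intro!: ennreal_leI)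
    then show ?thesis
      using that(2) by (simp add: finite_measure.emeasure_eq_measure)
  qed
qed

lemma finite_measure_density_exp:
  assumes "finite_measure Q" and g: "g \<in> borel_measurable Q"
    and "\<And>q. q \<in> space Q \<Longrightarrow> g q \<le> x"
  shows "finite_measure (density Q (\<lambda>q. ennreal (exp (g q))))"
proof -
  interpret finite_measure Q by fact
  have "emeasure (density Q (\<lambda>q. ennreal (exp (g q)))) (space Q) = (\<integral>\<^sup>+q. ennreal (exp (g q)) * indicator (space Q) q \<partial>Q)"
    using g by (subst emeasure_density) auto
  also have "\<dots> \<le> (\<integral>\<^sup>+q. ennreal (exp x) \<partial>Q)"
    using assms(3) by (intro nn_integral_mono) (auto split: split_indicator intro!: ennreal_leI)
  also have "\<dots> < \<infinity>"
    by (simp add: emeasure_eq_measure ennreal_mult_less_top)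
  finally show ?thesis
    by (intro finite_measureI) auto
qed

text \<open>
  Boundedness of \<open>H\<close> controls the error from \<open>\<alpha>(\<theta>)/\<theta> \<rightarrow> h\<close>, and continuity the error from
  \<open>H q \<rightarrow> H p\<close>.
\<close>
lemma tilt_exponent_local:
  fixes E :: "'a::topological_space set" and H :: "'a \<Rightarrow> real"
  assumes H: "continuous_on E H" "bounded (H ` E)"
    and \<alpha>: "((\<lambda>\<theta>. \<alpha> \<theta> / \<theta>) \<longlongrightarrow> h) at_top"
    and "p \<in> E" "\<eta> > 0"
  obtains W where "open W" "p \<in> W"
    "\<forall>\<^sub>F \<theta> in at_top. \<forall>q\<in>W \<inter> E. \<bar>\<alpha> \<theta> * H q - h * H p * \<theta>\<bar> \<le> \<eta> * \<theta>"
proof -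
  obtain B where B: "B > 0" "\<And>q. q \<in> E \<Longrightarrow> \<bar>H q\<bar> \<le> B"
    using H(2) unfolding bounded_pos by auto
  define d where "d = \<eta> / (2 * (\<bar>h\<bar> + 1))"
  have "d > 0" using \<open>\<eta> > 0\<close> unfolding d_def by (intro divide_pos_pos) auto
  obtain W where W: "open W" "p \<in> W" "\<And>q. q \<in> W \<inter> E \<Longrightarrow> H q \<in> ball (H p) d"
    using H(1)[unfolded continuous_on_topological, rule_format, OF \<open>p \<in> E\<close>, of "ball (H p) d"] \<open>d > 0\<close>
    by auto
  have "\<forall>\<^sub>F \<theta> in at_top. dist (\<alpha> \<theta> / \<theta>) h < \<eta> / (2 * B)"
    using \<open>\<eta> > 0\<close> B by (intro tendstoD[OF \<alpha>]) auto
  then have "\<forall>\<^sub>F \<theta> in at_top. \<forall>q\<in>W \<inter> E. \<bar>\<alpha> \<theta> * H q - h * H p * \<theta>\<bar> \<le> \<eta> * \<theta>"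
    using eventually_gt_at_top[of 0]
  proof eventually_elim
    case (elim \<theta>)
    show ?case
    proof
      fix q assume q: "q \<in> W \<inter> E"
      have "\<bar>H q - H p\<bar> \<le> d" using W(3)[OF q] by (auto simp: dist_real_def)
      have "\<bar>(\<alpha> \<theta> / \<theta> - h) * H q\<bar> \<le> \<eta> / (2 * B) * B"
        unfolding abs_mult using elim B q by (intro mult_mono) (auto simp: dist_real_def)
      also have "\<dots> = \<eta> / 2" using B by simp
      finally have 1: "\<bar>(\<alpha> \<theta> / \<theta> - h) * H q\<bar> \<le> \<eta> / 2" .
      have "\<bar>h * (H q - H p)\<bar> \<le> (\<bar>h\<bar> + 1) * d"
        unfolding abs_mult using \<open>\<bar>H q - H p\<bar> \<le> d\<close> by (intro mult_mono) auto
      also have "\<dots> = \<eta> / 2" unfolding d_def by (simp add: field_simps)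
      finally have 2: "\<bar>h * (H q - H p)\<bar> \<le> \<eta> / 2" .
      have *: "\<bar>(\<alpha> \<theta> / \<theta> - h) * H q + h * (H q - H p)\<bar> \<le> \<eta>"
        using order_trans[OF abs_triangle_ineq add_mono[OF 1 2]] by simp
      have "\<alpha> \<theta> * H q - h * H p * \<theta> = ((\<alpha> \<theta> / \<theta> - h) * H q + h * (H q - H p)) * \<theta>"
        using elim by (simp add: field_simps)
      then have "\<bar>\<alpha> \<theta> * H q - h * H p * \<theta>\<bar> = \<bar>(\<alpha> \<theta> / \<theta> - h) * H q + h * (H q - H p)\<bar> * \<theta>"
        using elim by (simp add: abs_mult)
      also have "\<dots> \<le> \<eta> * \<theta>" using * elim by (intro mult_right_mono) auto
      finally show "\<bar>\<alpha> \<theta> * H q - h * H p * \<theta>\<bar> \<le> \<eta> * \<theta>" .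
    qed
  qed
  then show ?thesis using that W by blast
qed

lemma borel_measurable_continuous_on_space:
  fixes H :: "'a::topological_space \<Rightarrow> real"
  assumes "sets M = sets (restrict_space borel E)" "continuous_on E H"
  shows "H \<in> borel_measurable M"
  using borel_measurable_continuous_on_restrict[OF assms(2)] measurable_cong_sets[OF assms(1) refl] by blast

text \<open>
  The limit \<open>h\<close> may be zero, so that both regimes of the tilting parameter are covered.
\<close>
locale tilting =
  fixes E :: "'a::polish_space set" and Q :: "real \<Rightarrow> 'a measure" and S :: "'a \<Rightarrow> ereal"
    and H :: "'a \<Rightarrow> real" and \<alpha> :: "real \<Rightarrow> real" and h :: real
  assumes cpt: "compact E"
    and prob: "\<And>\<theta>. \<theta> > 0 \<Longrightarrow> prob_space (Q \<theta>)"
    and sets_Q: "\<And>\<theta>. \<theta> > 0 \<Longrightarrow> sets (Q \<theta>) = sets (restrict_space borel E)"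
    and rate: "local_rate E (\<lambda>\<theta>. measure (Q \<theta>)) S"
    and H: "continuous_on E H" "bounded (H ` E)"
    and \<alpha>: "((\<lambda>\<theta>. \<alpha> \<theta> / \<theta>) \<longlongrightarrow> h) at_top"
begin

definition weighted :: "real \<Rightarrow> 'a measure" where
  "weighted \<theta> = density (Q \<theta>) (\<lambda>p. ennreal (exp (\<alpha> \<theta> * H p)))"

lemma space_Q: "\<theta> > 0 \<Longrightarrow> space (Q \<theta>) = E"
  using sets_eq_imp_space_eq[OF sets_Q] by (simp add: space_restrict_space)

lemma measurable_exponent: "\<theta> > 0 \<Longrightarrow> (\<lambda>p. \<alpha> \<theta> * H p) \<in> borel_measurable (Q \<theta>)"
  using borel_measurable_continuous_on_space[OF sets_Q H(1)] by simp

lemma sets_weighted: "\<theta> > 0 \<Longrightarrow> sets (weighted \<theta>) = sets (restrict_space borel E)"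
  by (simp add: weighted_def sets_Q)

lemma exponent_bound:
  obtains B where "B > 0" "\<And>\<theta> q. q \<in> E \<Longrightarrow> \<bar>\<alpha> \<theta> * H q\<bar> \<le> \<bar>\<alpha> \<theta>\<bar> * B"
proof -
  obtain B where "B > 0" "\<And>q. q \<in> E \<Longrightarrow> \<bar>H q\<bar> \<le> B"
    using H(2) unfolding bounded_pos by auto
  then show ?thesis using that by (simp add: abs_mult mult_left_mono)
qed

lemma finite_weighted: "\<theta> > 0 \<Longrightarrow> finite_measure (weighted \<theta>)"
proof -
  assume "\<theta> > 0"
  obtain B where "B > 0" "\<And>\<theta> q. q \<in> E \<Longrightarrow> \<bar>\<alpha> \<theta> * H q\<bar> \<le> \<bar>\<alpha> \<theta>\<bar> * B"
    using exponent_bound by metis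
  then show ?thesis
    unfolding weighted_def using prob[OF \<open>\<theta> > 0\<close>] measurable_exponent[OF \<open>\<theta> > 0\<close>] space_Q[OF \<open>\<theta> > 0\<close>]
    by (intro finite_measure_density_exp[where x = "\<bar>\<alpha> \<theta>\<bar> * B"])
       (auto intro: prob_space.finite_measure abs_le_D1)
qed

lemma weighted_pos: 
  assumes "\<theta> > 0" shows "measure (weighted \<theta>) E > 0"
proof -
  obtain B where B: "B > 0" "\<And>\<theta> q. q \<in> E \<Longrightarrow> \<bar>\<alpha> \<theta> * H q\<bar> \<le> \<bar>\<alpha> \<theta>\<bar> * B"
    using exponent_bound by metis
  have "0 < exp (- (\<bar>\<alpha> \<theta>\<bar> * B)) * measure (Q \<theta>) E"
    using prob_space.prob_space[OF prob[OF assms]] space_Q[OF assms] by simp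
  also have "\<dots> \<le> measure (weighted \<theta>) E"
    unfolding weighted_def
  proof (rule density_exp_measure_bounds(2))
    show "E \<in> sets (Q \<theta>)" using sets.top space_Q[OF assms] by metis
    show "- (\<bar>\<alpha> \<theta>\<bar> * B) \<le> \<alpha> \<theta> * H q" if "q \<in> E" for q
      using B(2)[OF that, of \<theta>] by linarith
  qed (use prob[OF assms] prob_space.finite_measure measurable_exponent[OF assms] finite_weighted[OF assms] in \<open>auto simp: weighted_def\<close>)
  finally show ?thesis .
qed

text \<open>
  Choose the neighbourhood so small that the exponent is \<open>(h H p \<plusminus> \<eta>) \<theta>\<close> on it; the error
  \<open>\<eta>\<close> is the slack between \<open>a\<close> and a number strictly between \<open>a\<close> and the rate.
\<close>
lemma local_rate_weighted: "local_rate E (\<lambda>\<theta>. measure (weighted \<theta>)) (\<lambda>p. S p - ereal (h * H p))"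
  unfolding local_rate_def
proof (intro conjI ballI allI impI)
  fix p a assume p: "p \<in> E" and a: "ereal a < S p - ereal (h * H p)"
  then have "ereal (a + h * H p) < S p"
    by (cases "S p") auto
  then obtain b where b: "ereal (a + h * H p) < ereal b" "ereal b < S p"
    using ereal_dense2 by blast
  define \<eta> where "\<eta> = b - (a + h * H p)"
  have "\<eta> > 0" using b by (simp add: \<eta>_def)
  obtain V where V: "open V" "p \<in> V" "\<forall>\<^sub>F \<theta> in at_top. measure (Q \<theta>) (V \<inter> E) \<le> exp (- (b * \<theta>))"
    using local_rate_upperE[OF rate p b(2)] .
  obtain W where W: "open W" "p \<in> W"
    "\<forall>\<^sub>F \<theta> in at_top. \<forall>q\<in>W \<inter> E. \<bar>\<alpha> \<theta> * H q - h * H p * \<theta>\<bar> \<le> \<eta> * \<theta>"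
    using tilt_exponent_local[OF H \<alpha> p \<open>\<eta> > 0\<close>] .
  have "\<forall>\<^sub>F \<theta> in at_top. measure (weighted \<theta>) (V \<inter> W \<inter> E) \<le> exp (- (a * \<theta>))"
    using V(3) W(3) eventually_gt_at_top[of 0]
  proof eventually_elim
    case (elim \<theta>)
    have fin: "finite_measure (Q \<theta>)" using prob elim by (simp add: prob_space.finite_measure)
    have meas: "V \<inter> W \<inter> E \<in> sets (Q \<theta>)" "V \<inter> E \<in> sets (Q \<theta>)"
      using V W elim by (auto intro!: sets_restrict_open_Int sets_Q)
    have "measure (weighted \<theta>) (V \<inter> W \<inter> E) \<le> exp ((h * H p + \<eta>) * \<theta>) * measure (Q \<theta>) (V \<inter> W \<inter> E)"
      unfolding weighted_def
    proof (rule density_exp_measure_bounds(1)[OF fin measurable_exponent[OF elim(3)] meas(1)])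
      fix q assume "q \<in> V \<inter> W \<inter> E"
      then have "\<bar>\<alpha> \<theta> * H q - h * H p * \<theta>\<bar> \<le> \<eta> * \<theta>" using elim(2) by blast
      then show "\<alpha> \<theta> * H q \<le> (h * H p + \<eta>) * \<theta>" by (simp add: abs_le_iff distrib_right)
    qed
    also have "\<dots> \<le> exp ((h * H p + \<eta>) * \<theta>) * exp (- (b * \<theta>))"
      using order_trans[OF finite_measure.finite_measure_mono[OF fin _ meas(2), of "V \<inter> W \<inter> E"] elim(1)]
      by (intro mult_left_mono) auto
    also have "\<dots> = exp (- (a * \<theta>))"
      by (simp add: \<eta>_def algebra_simps flip: exp_add)
    finally show ?case .
  qed
  then show "\<exists>V. open V \<and> p \<in> V \<and> (\<forall>\<^sub>F \<theta> in at_top. measure (weighted \<theta>) (V \<inter> E) \<le> exp (- (a * \<theta>)))"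
    using V W by (intro exI[of _ "V \<inter> W"]) auto
next
  fix p a V assume p: "p \<in> E" and a: "S p - ereal (h * H p) < ereal a" and V: "open V" "p \<in> V"
  then have "S p < ereal (a + h * H p)"
    by (cases "S p") auto
  then obtain b where b: "S p < ereal b" "ereal b < ereal (a + h * H p)"
    using ereal_dense2 by blast
  define \<eta> where "\<eta> = (a + h * H p) - b"
  have "\<eta> > 0" using b by (simp add: \<eta>_def)
  obtain W where W: "open W" "p \<in> W"
    "\<forall>\<^sub>F \<theta> in at_top. \<forall>q\<in>W \<inter> E. \<bar>\<alpha> \<theta> * H q - h * H p * \<theta>\<bar> \<le> \<eta> * \<theta>"
    using tilt_exponent_local[OF H \<alpha> p \<open>\<eta> > 0\<close>] .
  have "\<forall>\<^sub>F \<theta> in at_top. exp (- (b * \<theta>)) \<le> measure (Q \<theta>) (V \<inter> W \<inter> E)"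
    using local_rate_lowerD[OF rate p b(1), of "V \<inter> W"] V W by auto
  then show "\<forall>\<^sub>F \<theta> in at_top. exp (- (a * \<theta>)) \<le> measure (weighted \<theta>) (V \<inter> E)"
    using W(3) eventually_gt_at_top[of 0]
  proof eventually_elim
    case (elim \<theta>)
    have fin: "finite_measure (Q \<theta>)" using prob elim by (simp add: prob_space.finite_measure)
    have meas: "V \<inter> W \<inter> E \<in> sets (Q \<theta>)" "V \<inter> E \<in> sets (Q \<theta>)"
      using V W elim by (auto intro!: sets_restrict_open_Int sets_Q)
    have "exp (- (a * \<theta>)) = exp ((h * H p - \<eta>) * \<theta>) * exp (- (b * \<theta>))"
      by (simp add: \<eta>_def algebra_simps flip: exp_add)
    also have "\<dots> \<le> exp ((h * H p - \<eta>) * \<theta>) * measure (Q \<theta>) (V \<inter> W \<inter> E)"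
      using elim by (intro mult_left_mono) auto
    also have "\<dots> \<le> measure (weighted \<theta>) (V \<inter> W \<inter> E)"
      unfolding weighted_def
    proof (rule density_exp_measure_bounds(2)[OF fin measurable_exponent[OF elim(3)] meas(1)])
      fix q assume "q \<in> V \<inter> W \<inter> E"
      then have "\<bar>\<alpha> \<theta> * H q - h * H p * \<theta>\<bar> \<le> \<eta> * \<theta>" using elim(2) by blast
      then show "(h * H p - \<eta>) * \<theta> \<le> \<alpha> \<theta> * H q" by (simp add: abs_le_iff left_diff_distrib)
    qed (use finite_weighted[OF elim(3)] in \<open>simp add: weighted_def\<close>)
    also have "\<dots> \<le> measure (weighted \<theta>) (V \<inter> E)"
      using finite_weighted[of \<theta>] elim meas by (intro finite_measure.finite_measure_mono) (auto simp: weighted_def)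
    finally show ?case .
  qed
qed

lemma normalised_density:
  assumes "\<theta> > 0"
  defines "T \<equiv> density (Q \<theta>) (\<lambda>p. ennreal (exp (\<alpha> \<theta> * H p) / (\<integral>q. exp (\<alpha> \<theta> * H q) \<partial>Q \<theta>)))"
  shows "A \<in> sets (Q \<theta>) \<Longrightarrow> measure T A = measure (weighted \<theta>) A / measure (weighted \<theta>) E"
    and "prob_space T"
proof -
  let ?Z = "\<integral>q. exp (\<alpha> \<theta> * H q) \<partial>Q \<theta>"
  have m: "(\<lambda>p. exp (\<alpha> \<theta> * H p)) \<in> borel_measurable (Q \<theta>)"
    using measurable_exponent[OF assms(1)] by simp
  have Z: "?Z = measure (weighted \<theta>) E"
  proof -
    have "emeasure (weighted \<theta>) E = (\<integral>\<^sup>+q. ennreal (exp (\<alpha> \<theta> * H q)) * indicator (space (Q \<theta>)) q \<partial>Q \<theta>)"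
      unfolding weighted_def space_Q[OF assms(1), symmetric] using m by (subst emeasure_density) auto
    also have "\<dots> = (\<integral>\<^sup>+q. ennreal (exp (\<alpha> \<theta> * H q)) \<partial>Q \<theta>)"
      by (intro nn_integral_cong) auto
    finally show ?thesis
      using m by (simp add: integral_eq_nn_integral measure_def)
  qed
  have T: "emeasure T A = ennreal (measure (weighted \<theta>) A / measure (weighted \<theta>) E)" if "A \<in> sets (Q \<theta>)" for A
  proof -
    have "emeasure T A = (\<integral>\<^sup>+q. ennreal (exp (\<alpha> \<theta> * H q) / ?Z) * indicator A q \<partial>Q \<theta>)"
      unfolding T_def using m that by (subst emeasure_density) auto
    also have "\<dots> = (\<integral>\<^sup>+q. ennreal (1 / ?Z) * (ennreal (exp (\<alpha> \<theta> * H q)) * indicator A q) \<partial>Q \<theta>)"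
      by (intro nn_integral_cong) (simp add: Z divide_inverse ennreal_mult mult_ac)
    also have "\<dots> = ennreal (1 / ?Z) * emeasure (weighted \<theta>) A"
      unfolding weighted_def using m that by (subst nn_integral_cmult) (auto simp: emeasure_density)
    also have "\<dots> = ennreal (measure (weighted \<theta>) A / measure (weighted \<theta>) E)"
      using finite_measure.emeasure_eq_measure[OF finite_weighted[OF assms(1)]]
      unfolding Z by (simp add: divide_inverse mult_ac flip: ennreal_mult)
    finally show ?thesis .
  qed
  show "A \<in> sets (Q \<theta>) \<Longrightarrow> measure T A = measure (weighted \<theta>) A / measure (weighted \<theta>) E"
    using T by (simp add: measure_def[of T])
  show "prob_space T"
  proof
    have "space T = E" by (simp add: T_def space_Q[OF assms(1)])
    then show "emeasure T (space T) = 1"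
      using T[of E] weighted_pos[OF assms(1)] sets.top[of "Q \<theta>"] space_Q[OF assms(1)] by simp
  qed
qed

text \<open>
  This is the Laplace principle for the normalising constant: its rate is the infimum \<open>m\<close> of the
  rate of the unnormalised measures. The upper bound uses compactness of the whole space, the lower
  bound a single nearly optimal point.
\<close>
lemma partition_function_rate:
  assumes low: "\<forall>q\<in>E. ereal m \<le> S q - ereal (h * H q)"
    and att: "\<forall>x>m. \<exists>q\<in>E. S q - ereal (h * H q) < ereal x"
    and "\<eta> > 0"
  shows "\<forall>\<^sub>F \<theta> in at_top. exp (- ((m + \<eta>) * \<theta>)) \<le> measure (weighted \<theta>) E"
    and "\<forall>\<^sub>F \<theta> in at_top. measure (weighted \<theta>) E \<le> exp (- ((m - \<eta>) * \<theta>))"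
proof -
  obtain q where "q \<in> E" "S q - ereal (h * H q) < ereal (m + \<eta>)"
    using att[rule_format, of "m + \<eta>"] \<open>\<eta> > 0\<close> by auto
  then show "\<forall>\<^sub>F \<theta> in at_top. exp (- ((m + \<eta>) * \<theta>)) \<le> measure (weighted \<theta>) E"
    using local_rate_lowerD[OF local_rate_weighted, of q "m + \<eta>" UNIV] by auto
  show "\<forall>\<^sub>F \<theta> in at_top. measure (weighted \<theta>) E \<le> exp (- ((m - \<eta>) * \<theta>))"
  proof (rule eventually_measure_compact_le[where E = E and b = "m - \<eta> / 2"])
    show "\<exists>V. open V \<and> p \<in> V \<and> (\<forall>\<^sub>F \<theta> in at_top. measure (weighted \<theta>) (V \<inter> E) \<le> exp (- ((m - \<eta> / 2) * \<theta>)))"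
      if "p \<in> E" for p
    proof -
      have "ereal (m - \<eta> / 2) < ereal m" using \<open>\<eta> > 0\<close> by simp
      then have "ereal (m - \<eta> / 2) < S p - ereal (h * H p)" 
        using low[rule_format, OF that] by (rule less_le_trans)
      then show ?thesis using local_rate_upperE[OF local_rate_weighted that] by metis
    qed
  qed (use finite_weighted sets_weighted cpt \<open>\<eta> > 0\<close> in auto)
qed

lemma local_rate_normalised:
  assumes low: "\<forall>q\<in>E. ereal m \<le> S q - ereal (h * H q)"
    and att: "\<forall>x>m. \<exists>q\<in>E. S q - ereal (h * H q) < ereal x"
  shows "local_rate E (\<lambda>\<theta> A. measure (weighted \<theta>) A / measure (weighted \<theta>) E)
      (\<lambda>p. S p - ereal (h * H p) - ereal m)"
  unfolding local_rate_def
proof (intro conjI ballI allI impI)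
  fix p a assume p: "p \<in> E" and a: "ereal a < S p - ereal (h * H p) - ereal m"
  then have "ereal (a + m) < S p - ereal (h * H p)"
    by (cases "S p") auto
  then obtain b where b: "ereal (a + m) < ereal b" "ereal b < S p - ereal (h * H p)"
    using ereal_dense2 by blast
  define \<eta> where "\<eta> = b - (a + m)"
  have "\<eta> > 0" using b by (simp add: \<eta>_def)
  obtain V where V: "open V" "p \<in> V" "\<forall>\<^sub>F \<theta> in at_top. measure (weighted \<theta>) (V \<inter> E) \<le> exp (- (b * \<theta>))"
    using local_rate_upperE[OF local_rate_weighted p b(2)] .
  have "\<forall>\<^sub>F \<theta> in at_top. measure (weighted \<theta>) (V \<inter> E) / measure (weighted \<theta>) E \<le> exp (- (a * \<theta>))"
    using V(3) partition_function_rate(1)[OF low att \<open>\<eta> > 0\<close>] eventually_gt_at_top[of 0]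
  proof eventually_elim
    case (elim \<theta>)
    have "measure (weighted \<theta>) (V \<inter> E) / measure (weighted \<theta>) E \<le> exp (- (b * \<theta>)) / exp (- ((m + \<eta>) * \<theta>))"
      using elim by (intro frac_le) auto
    also have "\<dots> = exp (- (a * \<theta>))"
      by (simp add: \<eta>_def algebra_simps flip: exp_diff)
    finally show ?case .
  qed
  then show "\<exists>V. open V \<and> p \<in> V \<and>
      (\<forall>\<^sub>F \<theta> in at_top. measure (weighted \<theta>) (V \<inter> E) / measure (weighted \<theta>) E \<le> exp (- (a * \<theta>)))"
    using V by blast
next
  fix p a V assume p: "p \<in> E" and a: "S p - ereal (h * H p) - ereal m < ereal a" and V: "open V" "p \<in> V"
  then have "S p - ereal (h * H p) < ereal (a + m)"
    by (cases "S p") auto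
  then obtain b where b: "S p - ereal (h * H p) < ereal b" "ereal b < ereal (a + m)"
    using ereal_dense2 by blast
  define \<eta> where "\<eta> = a + m - b"
  have "\<eta> > 0" using b by (simp add: \<eta>_def)
  show "\<forall>\<^sub>F \<theta> in at_top. exp (- (a * \<theta>)) \<le> measure (weighted \<theta>) (V \<inter> E) / measure (weighted \<theta>) E"
    using local_rate_lowerD[OF local_rate_weighted p b(1) V]
      partition_function_rate(2)[OF low att \<open>\<eta> > 0\<close>] eventually_gt_at_top[of 0]
  proof eventually_elim
    case (elim \<theta>)
    have "exp (- (a * \<theta>)) = exp (- (b * \<theta>)) / exp (- ((m - \<eta>) * \<theta>))"
      by (simp add: \<eta>_def algebra_simps flip: exp_diff)
    also have "\<dots> \<le> measure (weighted \<theta>) (V \<inter> E) / measure (weighted \<theta>) E"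
      using elim weighted_pos by (intro frac_le) auto
    finally show ?case .
  qed
qed

text \<open>
  The supremum in the rate function is minus the rate of the normalising constant. It is a real
  number because \<open>H\<close> is bounded and \<open>S \<ge> 0\<close> is finite somewhere.
\<close>
theorem LDP_tilted:
  assumes fin: "\<exists>p\<in>E. S p < \<infinity>"
    and I: "\<And>p. p \<in> E \<Longrightarrow> I p = (SUP q\<in>E. ereal (h * H q) - S q) - (ereal (h * H p) - S p)"
  shows "LDP E (\<lambda>\<theta>. density (Q \<theta>) (\<lambda>p. ennreal (exp (\<alpha> \<theta> * H p) / (\<integral>q. exp (\<alpha> \<theta> * H q) \<partial>Q \<theta>)))) I"
    (is "LDP E ?T I")
proof -
  have S_nonneg: "0 \<le> S q" if "q \<in> E" for q
    using local_rate_nonneg[OF prob rate that] .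
  define \<Phi> where "\<Phi> q = ereal (h * H q) - S q" for q
  have \<Phi>_uminus: "S q - ereal (h * H q) = - \<Phi> q" if "q \<in> E" for q
    using S_nonneg[OF that] by (cases "S q") (auto simp: \<Phi>_def)
  obtain B where B: "B > 0" "\<And>q. q \<in> E \<Longrightarrow> \<bar>H q\<bar> \<le> B"
    using H(2) unfolding bounded_pos by auto
  have "\<Phi> q \<le> ereal (\<bar>h\<bar> * B)" if "q \<in> E" for q
  proof -
    have "h * H q \<le> \<bar>h\<bar> * B"
      using order_trans[OF abs_ge_self, of "h * H q"] mult_left_mono[OF B(2)[OF that], of "\<bar>h\<bar>"]
      by (simp add: abs_mult)
    then show ?thesis using S_nonneg[OF that] by (cases "S q") (auto simp: \<Phi>_def)
  qed
  then have "(SUP q\<in>E. \<Phi> q) \<le> ereal (\<bar>h\<bar> * B)"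
    by (rule SUP_least)
  moreover have "- \<infinity> < (SUP q\<in>E. \<Phi> q)"
  proof -
    obtain p where p: "p \<in> E" "S p < \<infinity>" using fin by blast
    then have "- \<infinity> < \<Phi> p" using S_nonneg[of p] by (cases "S p") (auto simp: \<Phi>_def)
    then show ?thesis using p by (meson SUP_upper less_le_trans)
  qed
  ultimately obtain M where M: "(SUP q\<in>E. \<Phi> q) = ereal M"
    by (cases "SUP q\<in>E. \<Phi> q") auto
  have low: "\<forall>q\<in>E. ereal (- M) \<le> S q - ereal (h * H q)"
  proof
    fix q assume that: "q \<in> E"
    have "\<Phi> q \<le> ereal M" using SUP_upper[OF that, of \<Phi>] M by simp
    then show "ereal (- M) \<le> S q - ereal (h * H q)" unfolding \<Phi>_uminus[OF that] by (cases "\<Phi> q") auto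
  qed
  have att: "\<forall>x>-M. \<exists>q\<in>E. S q - ereal (h * H q) < ereal x"
  proof (intro allI impI)
    fix x assume that: "- M < x"
    have "ereal (- x) < (SUP q\<in>E. \<Phi> q)" using that M by simp
    then obtain q where q: "q \<in> E" "ereal (- x) < \<Phi> q" by (auto simp: less_SUP_iff)
    then have "- \<Phi> q < ereal x" by (cases "\<Phi> q") auto
    then show "\<exists>q\<in>E. S q - ereal (h * H q) < ereal x" using q \<Phi>_uminus by auto
  qed
  show ?thesis
  proof (rule LDP_if_local_rate[OF cpt])
    show "prob_space (?T \<theta>)" if "\<theta> > 0" for \<theta> using normalised_density(2)[OF that] .
    show "sets (?T \<theta>) = sets (restrict_space borel E)" if "\<theta> > 0" for \<theta> using sets_Q[OF that] by simp
    have I_eq: "I p = S p - ereal (h * H p) - ereal (- M)" if "p \<in> E" for p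
      unfolding I[OF that] \<Phi>_def[symmetric] M \<Phi>_uminus[OF that] by (cases "\<Phi> p") auto
    have ev: "\<forall>\<^sub>F \<theta> in at_top. measure (?T \<theta>) (V \<inter> E) = measure (weighted \<theta>) (V \<inter> E) / measure (weighted \<theta>) E"
      if "open V" for V
      using eventually_gt_at_top[of 0]
    proof eventually_elim
      case (elim \<theta>)
      show ?case using elim sets_restrict_open_Int[OF sets_Q[OF elim] that]
        by (intro normalised_density(1)) auto
    qed
    note rate_norm = local_rate_normalised[OF low att]
    show "local_rate E (\<lambda>\<theta>. measure (?T \<theta>)) I"
      unfolding local_rate_def
    proof (intro conjI ballI allI impI)
      fix p a assume p: "p \<in> E" and "ereal a < I p"
      then have "ereal a < S p - ereal (h * H p) - ereal (- M)" by (simp only: I_eq)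
      then obtain V where V: "open V" "p \<in> V"
          "\<forall>\<^sub>F \<theta> in at_top. measure (weighted \<theta>) (V \<inter> E) / measure (weighted \<theta>) E \<le> exp (- (a * \<theta>))"
        by (rule local_rate_upperE[OF rate_norm p])
      have "\<forall>\<^sub>F \<theta> in at_top. measure (?T \<theta>) (V \<inter> E) \<le> exp (- (a * \<theta>))"
        using ev[OF V(1)] V(3) by eventually_elim simp
      then show "\<exists>V. open V \<and> p \<in> V \<and> (\<forall>\<^sub>F \<theta> in at_top. measure (?T \<theta>) (V \<inter> E) \<le> exp (- (a * \<theta>)))"
        using V by blast
    next
      fix p a V assume p: "p \<in> E" and "I p < ereal a" and V: "open V" "p \<in> V"
      then have "S p - ereal (h * H p) - ereal (- M) < ereal a" by (simp only: I_eq)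
      from local_rate_lowerD[OF rate_norm p this V] ev[OF V(1)]
      show "\<forall>\<^sub>F \<theta> in at_top. exp (- (a * \<theta>)) \<le> measure (?T \<theta>) (V \<inter> E)"
        by eventually_elim simp
    qed
  qed
qed

end

section \<open>Descending rearrangements\<close>

text \<open>
  Order the indices by decreasing value, ties being broken by the index. Since \<open>x\<close> is positive and
  tends to \<open>0\<close>, every index has finitely many predecessors; their number \<open>r\<close> is a bijection onto
  \<open>\<nat>\<close>, and its inverse enumerates \<open>x\<close> in descending order.
\<close>
lemma ex_descending_rearrangement:
  fixes x :: "nat \<Rightarrow> real"
  assumes pos: "\<And>i. 0 < x i" and lim: "x \<longlonglongrightarrow> 0"
  obtains \<sigma> where "bij \<sigma>" "decseq (x \<circ> \<sigma>)"
proof -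
  define R where "R i = {j. x i < x j \<or> x j = x i \<and> j < i}" for i
  define r where "r i = card (R i)" for i
  have fin: "finite (R i)" for i
  proof -
    have "\<forall>\<^sub>F j in sequentially. x j < x i"
      using order_tendstoD(2)[OF lim pos] .
    then obtain N where N: "\<And>j. j \<ge> N \<Longrightarrow> x j < x i" by (auto simp: eventually_sequentially)
    have "R i \<subseteq> {..<N}"
    proof
      fix j assume "j \<in> R i"
      then have "x i \<le> x j" by (auto simp: R_def)
      then show "j \<in> {..<N}" using N[of j] by (cases "j < N") auto
    qed
    then show ?thesis by (rule finite_subset) simp
  qed
  have mono: "r j < r i" if "j \<in> R i" for i j
  proof -
    have "R j \<subseteq> R i" "j \<notin> R j" using that by (auto simp: R_def)
    then have "R j \<subset> R i" using that by blast
    then show ?thesis unfolding r_def by (rule psubset_card_mono[OF fin])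
  qed
  have tot: "j \<in> R i \<or> i \<in> R j" if "i \<noteq> j" for i j
    using that unfolding R_def by (cases "x i" "x j" rule: linorder_cases) auto
  have inj: "inj r"
  proof (rule injI)
    fix i j assume "r i = r j"
    then have "j \<notin> R i" "i \<notin> R j" using mono[of j i] mono[of i j] by auto
    then show "i = j" using tot by blast
  qed
  have down: "r ` R i = {..<r i}" for i
  proof (rule card_subset_eq)
    show "r ` R i \<subseteq> {..<r i}" using mono by auto
    show "card (r ` R i) = card {..<r i}"
      using card_image[OF inj_on_subset[OF inj subset_UNIV], of "R i"] by (simp add: r_def)
  qed simp
  have "surj r"
  proof (rule ccontr)
    assume "\<not> surj r"
    then obtain k where k: "k \<notin> range r" by auto
    have "r i \<le> k" for i
    proof (rule ccontr)
      assume "\<not> r i \<le> k"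
      then have "k \<in> r ` R i" unfolding down by simp
      then show False using k by auto
    qed
    then have "range r \<subseteq> {..k}" by auto
    then have "finite (range r)" by (rule finite_subset) simp
    then show False using finite_imageD[OF _ inj] by simp
  qed
  then have bij: "bij r" using inj by (simp add: bij_def)
  have "decseq (x \<circ> inv r)"
    unfolding decseq_def comp_def
  proof (intro allI impI)
    fix m n :: nat assume "m \<le> n"
    let ?i = "inv r m" and ?j = "inv r n"
    have "r ?i \<le> r ?j" using \<open>surj r\<close> \<open>m \<le> n\<close> by (simp add: surj_f_inv_f)
    then have "?j \<notin> R ?i" using mono by (meson not_less)
    then show "x ?j \<le> x ?i" by (auto simp: R_def)
  qed
  moreover have "bij (inv r)" using bij by (rule bij_imp_bij_inv)
  ultimately show ?thesis using that by blast
qed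

text \<open>
  The criterion on the right does not mention \<open>\<sigma>\<close>. It therefore yields uniqueness of the
  descending rearrangement, it exhibits the \<open>k\<close>th largest entry as a measurable function of
  \<open>x\<close> (there are only countably many finite \<open>B\<close>), and it locates that entry when \<open>x\<close> is nearly sorted.
\<close>
lemma rearrangement_greater_iff:
  fixes x :: "nat \<Rightarrow> real"
  assumes "bij \<sigma>" "decseq (x \<circ> \<sigma>)"
  shows "t < (x \<circ> \<sigma>) k \<longleftrightarrow> (\<exists>B. finite B \<and> card B = Suc k \<and> (\<forall>i\<in>B. t < x i))"
proof
  assume t: "t < (x \<circ> \<sigma>) k"
  have "card (\<sigma> ` {..k}) = Suc k"
    using assms(1) by (subst card_image) (auto intro: inj_on_subset simp: bij_def)
  moreover have "t < x i" if "i \<in> \<sigma> ` {..k}" for i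
    using that t decseqD[OF assms(2)] by (fastforce intro: less_le_trans)
  ultimately show "\<exists>B. finite B \<and> card B = Suc k \<and> (\<forall>i\<in>B. t < x i)"
    by (intro exI[of _ "\<sigma> ` {..k}"]) auto
next
  assume "\<exists>B. finite B \<and> card B = Suc k \<and> (\<forall>i\<in>B. t < x i)"
  then obtain B where B: "finite B" "card B = Suc k" "\<forall>i\<in>B. t < x i" by blast
  have "\<not> B \<subseteq> \<sigma> ` {..<k}"
  proof
    assume "B \<subseteq> \<sigma> ` {..<k}"
    then have "card B \<le> card {..<k}" by (meson card_image_le card_mono finite_imageI finite_lessThan le_trans)
    then show False using B by simp
  qed
  then obtain i where i: "i \<in> B" "i \<notin> \<sigma> ` {..<k}" by blast
  obtain m where m: "i = \<sigma> m" using assms(1) by (metis bij_pointE)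
  then have "k \<le> m" using i by (auto simp: not_less[symmetric])
  then show "t < (x \<circ> \<sigma>) k" using B(3) i m decseqD[OF assms(2), of k m] by fastforce
qed

lemma descending_rearrangement_eq:
  assumes "bij \<sigma>" "decseq (x \<circ> \<sigma>)"
  shows "descending_rearrangement x = x \<circ> \<sigma>"
  unfolding descending_rearrangement_def
proof (rule the_equality)
  fix q assume "decseq q \<and> (\<exists>\<tau>. bij \<tau> \<and> q = x \<circ> \<tau>)"
  then obtain \<tau> where \<tau>: "bij \<tau>" "decseq (x \<circ> \<tau>)" "q = x \<circ> \<tau>" by auto
  have "t < (x \<circ> \<tau>) k \<longleftrightarrow> t < (x \<circ> \<sigma>) k" for t k
    by (simp only: rearrangement_greater_iff[OF \<tau>(1,2)] rearrangement_greater_iff[OF assms])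
  then show "q = x \<circ> \<sigma>"
    unfolding \<tau>(3) by (intro ext) (metis less_irrefl linorder_neqE_linordered_idom)
qed (use assms in auto)


section \<open>Stick-breaking sequences\<close>

definition break_fractions :: "(nat \<Rightarrow> real) set" where
  "break_fractions = {u. \<forall>i. 0 < u i \<and> u i < 1}"

lemma stick_breaking_pos: "u \<in> break_fractions \<Longrightarrow> 0 < stick_breaking u k"
  unfolding stick_breaking_def break_fractions_def by (auto intro!: mult_pos_pos prod_pos)

lemma sum_stick_breaking: "(\<Sum>i<n. stick_breaking u i) = 1 - (\<Prod>i<n. 1 - u i)"
  by (induction n) (auto simp: stick_breaking_def algebra_simps)

lemma prod_one_minus_bounds:
  assumes "u \<in> break_fractions"
  shows "0 < (\<Prod>i\<in>A. 1 - u i)" "(\<Prod>i\<in>A. 1 - u i) \<le> 1"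
  using assms by (auto simp: break_fractions_def less_imp_le intro!: prod_pos prod_le_1)

lemma prod_one_minus_antimono:
  assumes "u \<in> break_fractions" "finite B" "A \<subseteq> B"
  shows "(\<Prod>i\<in>B. 1 - u i) \<le> (\<Prod>i\<in>A. 1 - u i)"
proof -
  have "(\<Prod>i\<in>B. 1 - u i) = (\<Prod>i\<in>A. 1 - u i) * (\<Prod>i\<in>B - A. 1 - u i)"
    using assms by (metis prod.subset_diff mult.commute)
  also have "\<dots> \<le> (\<Prod>i\<in>A. 1 - u i) * 1"
    using prod_one_minus_bounds[OF assms(1)] by (intro mult_left_mono) (auto simp: less_imp_le)
  finally show ?thesis by simp
qed

text \<open>
  Removing a break before the index \<open>i\<close> only enlarges the piece broken off at \<open>i\<close>. With all
  breaks outside \<open>B\<close> removed, the pieces form a stick-breaking sequence of fractions indexed by \<open>B\<close>, whose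
  sum is the right-hand side.
\<close>
lemma sum_stick_breaking_le:
  assumes u: "u \<in> break_fractions" and "finite B"
  shows "(\<Sum>i\<in>B. stick_breaking u i) \<le> 1 - (\<Prod>i\<in>B. 1 - u i)"
  using \<open>finite B\<close>
proof (induction B rule: finite_linorder_max_induct)
  case (insert m B)
  then have "m \<notin> B" by auto
  have "stick_breaking u m \<le> (\<Prod>i\<in>B. 1 - u i) * u m"
    unfolding stick_breaking_def using insert u
    by (intro mult_right_mono prod_one_minus_antimono) (auto simp: break_fractions_def less_imp_le)
  then show ?case
    using insert \<open>m \<notin> B\<close> by (simp add: algebra_simps)
qed simp

lemma sum_stick_breaking_tail_le:
  assumes u: "u \<in> break_fractions" and "finite B" "\<And>i. i \<in> B \<Longrightarrow> N \<le> i"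
  shows "(\<Sum>i\<in>B. stick_breaking u i) \<le> (\<Prod>i<N. 1 - u i)"
proof -
  obtain M where M: "B \<subseteq> {..<M}" "N \<le> M"
    using \<open>finite B\<close> by (metis finite_nat_iff_bounded lessThan_subset_iff linear order_trans)
  have "(\<Sum>i\<in>B. stick_breaking u i) \<le> (\<Sum>i\<in>{..<M} - {..<N}. stick_breaking u i)"
    using assms M stick_breaking_pos[OF u] by (intro sum_mono2) (fastforce simp: less_imp_le)+
  also have "\<dots> = (\<Sum>i<M. stick_breaking u i) - (\<Sum>i<N. stick_breaking u i)"
    using M by (subst sum_diff) auto
  also have "\<dots> \<le> (\<Prod>i<N. 1 - u i)"
    using prod_one_minus_bounds[OF u, of "{..<M}"] by (simp add: sum_stick_breaking)
  finally show ?thesis .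
qed

lemma sum_stick_breaking_le_1:
  assumes "u \<in> break_fractions" "finite B"
  shows "(\<Sum>i\<in>B. stick_breaking u i) \<le> 1"
  using sum_stick_breaking_le[OF assms] prod_one_minus_bounds[OF assms(1), of B] by simp

lemma ranked_stick_breakingE:
  assumes u: "u \<in> break_fractions"
  obtains \<sigma> where "bij \<sigma>" "decseq (stick_breaking u \<circ> \<sigma>)"
    "descending_rearrangement (stick_breaking u) = stick_breaking u \<circ> \<sigma>"
proof -
  have "summable (stick_breaking u)"
    using sum_stick_breaking_le_1[OF u] stick_breaking_pos[OF u]
    by (intro summableI_nonneg_bounded[where x = 1]) (auto simp: less_imp_le)
  then have "stick_breaking u \<longlonglongrightarrow> 0" by (rule summable_LIMSEQ_zero)
  then obtain \<sigma> where "bij \<sigma>" "decseq (stick_breaking u \<circ> \<sigma>)"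
    by (rule ex_descending_rearrangement[OF stick_breaking_pos[OF u]])
  then show ?thesis using that descending_rearrangement_eq by simp
qed

lemma ranked_stick_breaking_in_nabla_bar:
  assumes u: "u \<in> break_fractions"
  shows "descending_rearrangement (stick_breaking u) \<in> nabla_bar"
proof -
  obtain \<sigma> where \<sigma>: "bij \<sigma>" "decseq (stick_breaking u \<circ> \<sigma>)"
    "descending_rearrangement (stick_breaking u) = stick_breaking u \<circ> \<sigma>"
    using ranked_stick_breakingE[OF u] .
  have nn: "0 \<le> (stick_breaking u \<circ> \<sigma>) k" for k
    using stick_breaking_pos[OF u] by (simp add: less_imp_le)
  have b: "(\<Sum>k<n. (stick_breaking u \<circ> \<sigma>) k) \<le> 1" for n
  proof -
    have "(\<Sum>k<n. (stick_breaking u \<circ> \<sigma>) k) = (\<Sum>i\<in>\<sigma> ` {..<n}. stick_breaking u i)"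
      using \<sigma>(1) by (subst sum.reindex) (auto intro: inj_on_subset simp: bij_def)
    then show ?thesis using sum_stick_breaking_le_1[OF u] by simp
  qed
  have s: "summable (stick_breaking u \<circ> \<sigma>)"
    using nn b by (rule summableI_nonneg_bounded)
  have "(\<Sum>k. (stick_breaking u \<circ> \<sigma>) k) \<le> 1"
    using s b by (rule suminf_le_const)
  then show ?thesis using \<sigma>(2) nn s unfolding \<sigma>(3) nabla_bar_def by blast
qed

lemma ranked_greater_iff:
  assumes u: "u \<in> break_fractions"
  shows "t < descending_rearrangement (stick_breaking u) k \<longleftrightarrow>
    (\<exists>B. finite B \<and> card B = Suc k \<and> (\<forall>i\<in>B. t < stick_breaking u i))"
proof -
  obtain \<sigma> where \<sigma>: "bij \<sigma>" "decseq (stick_breaking u \<circ> \<sigma>)"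
    "descending_rearrangement (stick_breaking u) = stick_breaking u \<circ> \<sigma>"
    using ranked_stick_breakingE[OF u] .
  show ?thesis unfolding \<sigma>(3) by (rule rearrangement_greater_iff[OF \<sigma>(1,2)])
qed

text \<open>
  Either the mass remaining after \<open>N\<close> breaks exceeds \<open>d\<close>, or the pieces below \<open>N\<close> among the
  \<open>n\<close> largest already have sum above \<open>t - d\<close>. Maps into \<open>{..N}\<close> encode the possible index sets:
  indices \<open>\<ge> N\<close> are sent to \<open>N\<close>, which only adds a factor below \<open>1\<close> to the product, and the
  number of maps is \<open>(N + 1)\<^sup>n\<close>.
\<close>
lemma top_sum_greater_cases:
  assumes u: "u \<in> break_fractions"
    and t: "t < (\<Sum>k<n. descending_rearrangement (stick_breaking u) k)"
  shows "d < (\<Prod>i<N. 1 - u i) \<or>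
    (\<exists>f\<in>{..<n} \<rightarrow>\<^sub>E {..N}. (\<Prod>i\<in>f ` {..<n}. 1 - u i) < 1 - t + d)"
proof (cases "d < (\<Prod>i<N. 1 - u i)")
  case False
  then have d: "(\<Prod>i<N. 1 - u i) \<le> d" by simp
  obtain \<sigma> where \<sigma>: "bij \<sigma>" "decseq (stick_breaking u \<circ> \<sigma>)"
    "descending_rearrangement (stick_breaking u) = stick_breaking u \<circ> \<sigma>"
    using ranked_stick_breakingE[OF u] .
  define B where "B = \<sigma> ` {..<n}"
  define f where "f = (\<lambda>k\<in>{..<n}. min (\<sigma> k) N)"
  have finB: "finite B" by (simp add: B_def)
  have "t < (\<Sum>i\<in>B. stick_breaking u i)"
  proof -
    have "inj_on \<sigma> {..<n}" using \<sigma>(1) by (auto intro: inj_on_subset simp: bij_def)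
    then show ?thesis using t unfolding \<sigma>(3) B_def by (simp add: sum.reindex)
  qed
  also have "\<dots> = (\<Sum>i\<in>B \<inter> {..<N}. stick_breaking u i) + (\<Sum>i\<in>B - {..<N}. stick_breaking u i)"
    by (rule sum.Int_Diff[OF finB])
  also have "\<dots> \<le> (1 - (\<Prod>i\<in>B \<inter> {..<N}. 1 - u i)) + (\<Prod>i<N. 1 - u i)"
    using finB by (intro add_mono sum_stick_breaking_le sum_stick_breaking_tail_le u) auto
  finally have "(\<Prod>i\<in>B \<inter> {..<N}. 1 - u i) < 1 - t + d" using d by linarith
  moreover have "(\<Prod>i\<in>f ` {..<n}. 1 - u i) \<le> (\<Prod>i\<in>B \<inter> {..<N}. 1 - u i)"
  proof (rule prod_one_minus_antimono[OF u])
    show "B \<inter> {..<N} \<subseteq> f ` {..<n}"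
    proof
      fix i assume "i \<in> B \<inter> {..<N}"
      then obtain k where "k < n" "i = \<sigma> k" "i < N" by (auto simp: B_def)
      then show "i \<in> f ` {..<n}" by (intro image_eqI[of _ _ k]) (auto simp: f_def)
    qed
  qed simp
  ultimately have "\<exists>f\<in>{..<n} \<rightarrow>\<^sub>E {..N}. (\<Prod>i\<in>f ` {..<n}. 1 - u i) < 1 - t + d"
    by (intro bexI[of _ f]) (auto simp: f_def)
  then show ?thesis ..
qed simp

text \<open>
  A piece is a product of numbers in \<open>[0,1]\<close>, and such products are 1-Lipschitz in each factor.
\<close>
lemma stick_breaking_lipschitz:
  assumes "\<And>i. i \<le> k \<Longrightarrow> 0 \<le> u i \<and> u i \<le> 1" "\<And>i. i \<le> k \<Longrightarrow> 0 \<le> v i \<and> v i \<le> 1"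
  shows "\<bar>stick_breaking u k - stick_breaking v k\<bar> \<le> (\<Sum>i\<le>k. \<bar>u i - v i\<bar>)"
proof -
  define c where "c w i = (if i < k then 1 - w i else w i)" for w :: "nat \<Rightarrow> real" and i
  have c: "stick_breaking w k = (\<Prod>i\<le>k. c w i)" for w
    by (simp add: stick_breaking_def c_def lessThan_Suc_atMost[symmetric] lessThan_Suc)
  have "norm ((\<Prod>i\<le>k. c u i) - (\<Prod>i\<le>k. c v i)) \<le> (\<Sum>i\<le>k. norm (c u i - c v i))"
    using assms by (intro norm_prod_diff) (auto simp: c_def)
  also have "\<dots> = (\<Sum>i\<le>k. \<bar>u i - v i\<bar>)"
    by (intro sum.cong) (auto simp: c_def)
  finally show ?thesis by (simp add: c)
qed

text \<open>
  If more than \<open>k\<close> pieces exceeded \<open>p k + \<epsilon>\<close>, one of them would have index at least \<open>k\<close>, but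
  such pieces are at most \<open>p k + \<epsilon>\<close>. Conversely the pieces \<open>0, \<dots>, k\<close> are all at least
  \<open>p k - \<epsilon>\<close>.
\<close>
lemma ranked_near:
  assumes u: "u \<in> break_fractions" and p: "p \<in> nabla_bar"
    and near: "\<And>k. k < n \<Longrightarrow> \<bar>stick_breaking u k - p k\<bar> \<le> \<epsilon>"
    and small: "\<And>i. n \<le> i \<Longrightarrow> stick_breaking u i \<le> \<epsilon>"
    and "k < n"
  shows "\<bar>descending_rearrangement (stick_breaking u) k - p k\<bar> \<le> \<epsilon>"
proof -
  let ?q = "descending_rearrangement (stick_breaking u)"
  have dec: "p j \<le> p i" if "i \<le> j" for i j using p that by (auto simp: nabla_bar_def decseq_def)
  have nn: "0 \<le> p i" for i using p by (auto simp: nabla_bar_def)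
  have "\<not> p k + \<epsilon> < ?q k"
  proof
    assume "p k + \<epsilon> < ?q k"
    then obtain B where B: "finite B" "card B = Suc k" "\<forall>i\<in>B. p k + \<epsilon> < stick_breaking u i"
      using ranked_greater_iff[OF u] by blast
    have "\<not> B \<subseteq> {..<k}" using B card_mono[of "{..<k}" B] by auto
    then obtain i where i: "i \<in> B" "k \<le> i" by (meson lessThan_iff not_le subsetI)
    have "stick_breaking u i \<le> p k + \<epsilon>"
    proof (cases "i < n")
      case True then show ?thesis using near[of i] dec[OF i(2)] by linarith
    next
      case False then show ?thesis using small[of i] nn[of k] by simp
    qed
    then show False using B(3) i by fastforce
  qed
  moreover have "\<not> ?q k < p k - \<epsilon>"
  proof
    assume "?q k < p k - \<epsilon>"
    then obtain t where t: "?q k < t" "t < p k - \<epsilon>" using dense by blast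
    have "t < stick_breaking u i" if "i \<le> k" for i
    proof -
      have "i < n" using that \<open>k < n\<close> by simp
      then show ?thesis using near[of i] dec[OF that] t by linarith
    qed
    then have "t < ?q k"
      unfolding ranked_greater_iff[OF u] by (intro exI[of _ "{..k}"]) auto
    then show False using t by simp
  qed
  ultimately show ?thesis by linarith
qed

text \<open>
  The fractions \<open>w\<close> for which stick-breaking produces the prescribed pieces \<open>q\<close>.
\<close>
lemma stick_breaking_inverse:
  assumes "\<And>k. k < n \<Longrightarrow> (\<Sum>i<k. q i) < 1"
  defines "w \<equiv> \<lambda>k. q k / (1 - (\<Sum>i<k. q i))"
  shows "k \<le> n \<Longrightarrow> (\<Prod>i<k. 1 - w i) = 1 - (\<Sum>i<k. q i)"
    and "k < n \<Longrightarrow> stick_breaking w k = q k"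
proof -
  show *: "k \<le> n \<Longrightarrow> (\<Prod>i<k. 1 - w i) = 1 - (\<Sum>i<k. q i)" for k
  proof (induction k)
    case (Suc k)
    have "1 - (\<Sum>i<k. q i) \<noteq> 0" using assms(1)[of k] Suc.prems by simp
    then have "(1 - (\<Sum>i<k. q i)) * (1 - w k) = 1 - (\<Sum>i<k. q i) - q k"
      unfolding w_def by (simp add: field_simps)
    then show ?case using Suc by simp
  qed simp
  show "k < n \<Longrightarrow> stick_breaking w k = q k"
    using *[of k] assms(1)[of k] by (simp add: stick_breaking_def w_def)
qed

lemma closed_nabla_bar: "closed nabla_bar"
proof -
  have eq: "nabla_bar = {p. \<forall>i j. i \<le> j \<longrightarrow> p j \<le> p i} \<inter> {p. \<forall>k. 0 \<le> p k} \<inter> {p. \<forall>n. (\<Sum>k<n. p k) \<le> 1}"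
  proof (intro set_eqI iffI)
    fix p assume "p \<in> nabla_bar"
    then show "p \<in> {p. \<forall>i j. i \<le> j \<longrightarrow> p j \<le> p i} \<inter> {p. \<forall>k. 0 \<le> p k} \<inter> {p. \<forall>n. (\<Sum>k<n. p k) \<le> 1}"
      by (auto simp: nabla_bar_def decseq_def intro: order_trans[OF sum_le_suminf])
  next
    fix p :: "nat \<Rightarrow> real"
    assume *: "p \<in> {p. \<forall>i j. i \<le> j \<longrightarrow> p j \<le> p i} \<inter> {p. \<forall>k. 0 \<le> p k} \<inter> {p. \<forall>n. (\<Sum>k<n. p k) \<le> 1}"
    then have "summable p" by (intro summableI_nonneg_bounded[where x = 1]) auto
    then show "p \<in> nabla_bar"
      using * by (auto simp: nabla_bar_def decseq_def intro!: suminf_le_const)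
  qed
  moreover have "closed {p :: nat \<Rightarrow> real. \<forall>i j. i \<le> j \<longrightarrow> p j \<le> p i}"
    by (intro closed_Collect_all closed_Collect_imp closed_Collect_le continuous_intros continuous_on_product_coordinates) auto
  moreover have "closed {p :: nat \<Rightarrow> real. \<forall>k. 0 \<le> p k}"
    by (intro closed_Collect_all closed_Collect_le continuous_intros continuous_on_product_coordinates) 
  moreover have "closed {p :: nat \<Rightarrow> real. \<forall>n. (\<Sum>k<n. p k) \<le> 1}"
    by (intro closed_Collect_all closed_Collect_le continuous_intros continuous_on_product_coordinates) 
  ultimately show ?thesis unfolding eq by (intro closed_Int)
qed

lemma compact_nabla_bar: "compact nabla_bar"
proof -
  have "compactin (product_topology (\<lambda>i. euclidean) UNIV) (\<Pi>\<^sub>E i\<in>(UNIV::nat set). {0..1::real})"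
    by (auto simp: compactin_PiE)
  then have c: "compact (\<Pi>\<^sub>E i\<in>(UNIV::nat set). {0..1::real})"
    by (simp add: euclidean_product_topology)
  have "nabla_bar \<subseteq> (\<Pi>\<^sub>E i\<in>(UNIV::nat set). {0..1::real})"
  proof
    fix p assume p: "p \<in> nabla_bar"
    have "p k \<le> 1" for k
    proof -
      have "p k = (\<Sum>i\<in>{k}. p i)" by simp
      also have "\<dots> \<le> (\<Sum>i. p i)" using p by (intro sum_le_suminf) (auto simp: nabla_bar_def)
      finally show ?thesis using p by (simp add: nabla_bar_def)
    qed
    then show "p \<in> (\<Pi>\<^sub>E i\<in>(UNIV::nat set). {0..1::real})" using p by (auto simp: nabla_bar_def)
  qed
  then show ?thesis
    using compact_Int_closed[OF c closed_nabla_bar] by (simp add: Int_absorb1)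
qed

lemma open_fun_boxE:
  fixes p :: "nat \<Rightarrow> real"
  assumes "open V" "p \<in> V"
  obtains n \<epsilon> where "\<epsilon> > 0" "\<And>q. (\<And>k. k < n \<Longrightarrow> \<bar>q k - p k\<bar> \<le> \<epsilon>) \<Longrightarrow> q \<in> V"
proof -
  have "openin (product_topology (\<lambda>i. euclidean) UNIV) V"
    using assms by (simp add: open_fun_def)
  from product_topology_open_contains_basis[OF this \<open>p \<in> V\<close>]
  obtain X where X: "p \<in> (\<Pi>\<^sub>E i\<in>UNIV. X i)" "\<And>i. open (X i)" "finite {i. X i \<noteq> UNIV}"
      "(\<Pi>\<^sub>E i\<in>UNIV. X i) \<subseteq> V"
    by auto
  have "\<exists>e>0. \<forall>y. \<bar>y - p i\<bar> \<le> e \<longrightarrow> y \<in> X i" for i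
  proof -
    obtain e where e: "e > 0" "cball (p i) e \<subseteq> X i"
      using X(1) X(2)[of i] unfolding open_contains_cball PiE_iff by blast
    then show ?thesis by (intro exI[of _ e]) (auto simp: dist_real_def subset_iff abs_minus_commute)
  qed
  then obtain e where e: "\<And>i. e i > 0" "\<And>i y. \<bar>y - p i\<bar> \<le> e i \<Longrightarrow> y \<in> X i" by metis
  obtain n where n: "{i. X i \<noteq> UNIV} \<subseteq> {..<n}" using X(3) finite_nat_iff_bounded by blast
  define \<epsilon> where "\<epsilon> = Min (insert 1 (e ` {..<n}))"
  show ?thesis
  proof (rule that)
    show "\<epsilon> > 0" unfolding \<epsilon>_def using e(1) by (subst Min_gr_iff) auto
    fix q assume q: "\<And>k. k < n \<Longrightarrow> \<bar>q k - p k\<bar> \<le> \<epsilon>"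
    have "q i \<in> X i" for i
    proof (cases "i < n")
      case True
      then have "\<epsilon> \<le> e i" unfolding \<epsilon>_def by (intro Min_le) auto
      then show ?thesis using q[OF True] e(2) by fastforce
    qed (use n in auto)
    then show "q \<in> V" using X(4) by auto
  qed
qed

section \<open>Independent beta fractions\<close>

lemma space_beta_one: "space (beta_one \<theta>) = {0<..<1}"
  by (simp add: beta_one_def space_restrict_space)

lemma measurable_beta_one:
  "f \<in> borel_measurable borel \<Longrightarrow> f \<in> borel_measurable (beta_one \<theta>)"
  unfolding beta_one_def by (simp add: measurable_restrict_space1)

lemma nn_integral_beta_one:
  assumes [measurable]: "f \<in> borel_measurable borel"
  shows "(\<integral>\<^sup>+x. f x \<partial>beta_one \<theta>) =
    (\<integral>\<^sup>+x. ennreal (\<theta> * (1 - x) powr (\<theta> - 1)) * f x * indicator {0<..<1} x \<partial>lborel)"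
  unfolding beta_one_def
  by (subst nn_integral_density)
     (auto intro!: measurable_restrict_space1 simp: nn_integral_restrict_space)

text \<open>
  The moments of order \<open>1\<close>, \<open>2\<close> and \<open>1 - \<theta>\<close> are the ones that the estimates below need. The order
  \<open>1 - \<theta>\<close> turns the density into a constant, and the moment is \<open>\<theta>\<close>.
\<close>
lemma beta_one_moment:
  assumes "0 < \<theta>" "0 < \<theta> + a"
  shows "(\<integral>\<^sup>+x. ennreal ((1 - x) powr a) \<partial>beta_one \<theta>) = ennreal (\<theta> / (\<theta> + a))"
proof -
  have "((\<lambda>x. \<theta> * x powr (\<theta> + a - 1)) has_integral \<theta> * (1 powr (\<theta> + a - 1 + 1) / (\<theta> + a - 1 + 1))) {0..1}"
    using assms by (intro has_integral_mult_right has_integral_powr_from_0) auto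
  then have I: "((\<lambda>x. \<theta> * x powr (\<theta> + a - 1)) has_integral \<theta> / (\<theta> + a)) {0..1}"
    by simp
  have "(\<integral>\<^sup>+x. ennreal ((1 - x) powr a) \<partial>beta_one \<theta>) =
      (\<integral>\<^sup>+x. ennreal (\<theta> * (1 - x) powr (\<theta> - 1)) * ennreal ((1 - x) powr a) * indicator {0<..<1} x \<partial>lborel)"
    by (rule nn_integral_beta_one) simp
  also have "\<dots> = (\<integral>\<^sup>+x. ennreal (\<theta> * x powr (\<theta> - 1)) * ennreal (x powr a) * indicator {0<..<1} (1 - x) \<partial>lborel)"
    by (subst nn_integral_real_affine[where c = "-1" and t = 1]) auto
  also have "\<dots> = (\<integral>\<^sup>+x. ennreal (indicator {0..1} x * (\<theta> * x powr (\<theta> + a - 1))) \<partial>lborel)"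
  proof (rule nn_integral_cong_AE)
    show "AE x in lborel. ennreal (\<theta> * x powr (\<theta> - 1)) * ennreal (x powr a) * indicator {0<..<1} (1 - x) =
        ennreal (indicator {0..1} x * (\<theta> * x powr (\<theta> + a - 1)))"
      using AE_lborel_singleton[of 1] AE_lborel_singleton[of 0]
    proof eventually_elim
      case (elim x)
      have "x powr (\<theta> - 1) * x powr a = x powr (\<theta> + a - 1)"
        by (simp add: algebra_simps flip: powr_add)
      then show ?case
        using elim assms by (auto simp: indicator_def mult.assoc simp flip: ennreal_mult)
    qed
  qed
  also have "\<dots> = ennreal (\<theta> / (\<theta> + a))"
    using assms by (intro nn_integral_has_integral_lebesgue I) auto
  finally show ?thesis .
qed

lemma prob_space_beta_one: "0 < \<theta> \<Longrightarrow> prob_space (beta_one \<theta>)"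
proof (rule prob_spaceI)
  assume \<theta>: "0 < \<theta>"
  have "emeasure (beta_one \<theta>) (space (beta_one \<theta>)) = (\<integral>\<^sup>+x. 1 \<partial>beta_one \<theta>)"
    by simp
  also have "\<dots> = (\<integral>\<^sup>+x. ennreal ((1 - x) powr 0) \<partial>beta_one \<theta>)"
    by (intro nn_integral_cong) (auto simp: space_beta_one)
  also have "\<dots> = 1" using beta_one_moment[of \<theta> 0] \<theta> by simp
  finally show "emeasure (beta_one \<theta>) (space (beta_one \<theta>)) = 1" .
qed

lemma beta_one_second_moment:
  assumes "0 < \<theta>"
  shows "(\<integral>\<^sup>+x. ennreal (x\<^sup>2) \<partial>beta_one \<theta>) = ennreal (2 / ((\<theta> + 1) * (\<theta> + 2)))"
proof -
  have i1: "(\<integral>\<^sup>+x. ennreal (1 - x) \<partial>beta_one \<theta>) = ennreal (\<theta> / (\<theta> + 1))"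
  proof -
    have "(\<integral>\<^sup>+x. ennreal (1 - x) \<partial>beta_one \<theta>) = (\<integral>\<^sup>+x. ennreal ((1 - x) powr 1) \<partial>beta_one \<theta>)"
      by (intro nn_integral_cong) (simp add: space_beta_one)
    then show ?thesis using beta_one_moment[of \<theta> 1] assms by simp
  qed
  have i2: "(\<integral>\<^sup>+x. ennreal ((1 - x)\<^sup>2) \<partial>beta_one \<theta>) = ennreal (\<theta> / (\<theta> + 2))"
  proof -
    have "(\<integral>\<^sup>+x. ennreal ((1 - x)\<^sup>2) \<partial>beta_one \<theta>) = (\<integral>\<^sup>+x. ennreal ((1 - x) powr 2) \<partial>beta_one \<theta>)"
      by (intro nn_integral_cong) (simp add: space_beta_one powr_numeral)
    then show ?thesis using beta_one_moment[of \<theta> 2] assms by simp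
  qed
  have m: "(\<lambda>x. ennreal (x\<^sup>2)) \<in> borel_measurable (beta_one \<theta>)"
    "(\<lambda>x. ennreal (1 - x)) \<in> borel_measurable (beta_one \<theta>)"
    "(\<lambda>x. ennreal ((1 - x)\<^sup>2)) \<in> borel_measurable (beta_one \<theta>)"
    by (rule measurable_beta_one, simp)+
  have "(\<integral>\<^sup>+x. ennreal (x\<^sup>2) \<partial>beta_one \<theta>) + ennreal (2 * (\<theta> / (\<theta> + 1)))
      = (\<integral>\<^sup>+x. ennreal (x\<^sup>2) \<partial>beta_one \<theta>) + (\<integral>\<^sup>+x. ennreal 2 * ennreal (1 - x) \<partial>beta_one \<theta>)"
    using assms by (simp only: nn_integral_cmult[OF m(2)] i1 ennreal_mult[symmetric] zero_le_numeral
        divide_nonneg_nonneg add_nonneg_nonneg less_imp_le zero_le_one)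
  also have "\<dots> = (\<integral>\<^sup>+x. ennreal (x\<^sup>2) + ennreal 2 * ennreal (1 - x) \<partial>beta_one \<theta>)"
    using m by (intro nn_integral_add[symmetric] borel_measurable_times_ennreal) auto
  also have "\<dots> = (\<integral>\<^sup>+x. 1 + ennreal ((1 - x)\<^sup>2) \<partial>beta_one \<theta>)"
  proof (rule nn_integral_cong)
    fix x assume x: "x \<in> space (beta_one \<theta>)"
    have "ennreal (x\<^sup>2) + ennreal 2 * ennreal (1 - x) = ennreal (x\<^sup>2 + 2 * (1 - x))"
      using x by (simp only: space_beta_one ennreal_mult[symmetric] ennreal_plus[symmetric]
          zero_le_numeral zero_le_power2 greaterThanLessThan_iff less_imp_le diff_ge_0_iff_ge mult_nonneg_nonneg)
    also have "x\<^sup>2 + 2 * (1 - x) = 1 + (1 - x)\<^sup>2" by (simp add: power2_eq_square algebra_simps)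
    finally show "ennreal (x\<^sup>2) + ennreal 2 * ennreal (1 - x) = 1 + ennreal ((1 - x)\<^sup>2)"
      by (simp add: ennreal_plus)
  qed
  also have "\<dots> = 1 + ennreal (\<theta> / (\<theta> + 2))"
    using m prob_space.emeasure_space_1[OF prob_space_beta_one[OF assms]]
    by (subst nn_integral_add) (auto simp: i2)
  also have "\<dots> = ennreal (2 / ((\<theta> + 1) * (\<theta> + 2))) + ennreal (2 * (\<theta> / (\<theta> + 1)))"
  proof -
    have "1 + \<theta> / (\<theta> + 2) = 2 / ((\<theta> + 1) * (\<theta> + 2)) + 2 * (\<theta> / (\<theta> + 1))"
      using assms by (simp add: divide_simps) algebra
    then show ?thesis using assms by (simp flip: ennreal_plus ennreal_1)
  qed
  finally show ?thesis by (simp add: ennreal_add_left_cancel add.commute)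
qed

lemma beta_one_interval_ge:
  assumes "1 \<le> \<theta>" "0 \<le> l" "l < r" "r < 1"
  shows "(r - l) * (1 - r) powr \<theta> \<le> measure (beta_one \<theta>) {l<..<r}"
proof -
  interpret prob_space "beta_one \<theta>" using assms by (intro prob_space_beta_one) simp
  have ms: "{l<..<r} \<in> sets (beta_one \<theta>)"
    using assms unfolding beta_one_def by (auto simp: sets_restrict_space_iff)
  have "ennreal ((r - l) * (1 - r) powr \<theta>) = (\<integral>\<^sup>+x. ennreal ((1 - r) powr \<theta>) * indicator {l<..<r} x \<partial>lborel)"
    using assms by (subst nn_integral_cmult_indicator) (auto simp: mult.commute simp flip: ennreal_mult)
  also have "\<dots> \<le> (\<integral>\<^sup>+x. ennreal (\<theta> * (1 - x) powr (\<theta> - 1)) * indicator {l<..<r} x * indicator {0<..<1} x \<partial>lborel)"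
  proof (rule nn_integral_mono)
    fix x
    show "ennreal ((1 - r) powr \<theta>) * indicator {l<..<r} x
        \<le> ennreal (\<theta> * (1 - x) powr (\<theta> - 1)) * indicator {l<..<r} x * indicator {0<..<1} x"
    proof (cases "x \<in> {l<..<r}")
      case True
      have "(1 - r) powr \<theta> \<le> (1 - r) powr (\<theta> - 1)"
        using assms by (intro powr_mono') auto
      also have "\<dots> \<le> (1 - x) powr (\<theta> - 1)"
        using assms True by (intro powr_mono2) auto
      also have "\<dots> \<le> \<theta> * (1 - x) powr (\<theta> - 1)"
        using assms mult_right_mono[of 1 \<theta> "(1 - x) powr (\<theta> - 1)"] by simp
      finally show ?thesis using True assms by (auto intro!: ennreal_leI)
    qed simp
  qed
  also have "\<dots> = (\<integral>\<^sup>+x. indicator {l<..<r} x \<partial>beta_one \<theta>)"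
    by (rule nn_integral_beta_one[symmetric]) simp
  also have "\<dots> = ennreal (prob {l<..<r})"
    using ms by (simp add: emeasure_eq_measure)
  finally show ?thesis by simp
qed

definition sticks :: "real \<Rightarrow> (nat \<Rightarrow> real) measure" where
  "sticks \<theta> = (\<Pi>\<^sub>M i\<in>(UNIV::nat set). beta_one \<theta>)"

lemma prob_space_sticks: "0 < \<theta> \<Longrightarrow> prob_space (sticks \<theta>)"
  unfolding sticks_def by (intro prob_space_PiM prob_space_beta_one)

lemma space_sticks: "space (sticks \<theta>) = break_fractions"
  by (auto simp: sticks_def space_PiM space_beta_one break_fractions_def PiE_iff)

lemma measurable_sticks_coordinate:
  assumes "f \<in> borel_measurable borel"
  shows "(\<lambda>u. f (u i)) \<in> borel_measurable (sticks \<theta>)"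
proof -
  have "(\<lambda>u. u i) \<in> measurable (sticks \<theta>) (beta_one \<theta>)"
    unfolding sticks_def by simp
  from measurable_compose[OF this measurable_beta_one[OF assms]] show ?thesis .
qed

lemma measurable_sticks_coord[measurable]: "(\<lambda>u. u i) \<in> borel_measurable (sticks \<theta>)"
  by (rule measurable_sticks_coordinate[of "\<lambda>x. x"]) simp

lemma measurable_stick_breaking[measurable]:
  "(\<lambda>u. stick_breaking u k) \<in> borel_measurable (sticks \<theta>)"
  unfolding stick_breaking_def by measurable

text \<open>
  All uses of independence go through this formula: an event is bounded by a product of functions of
  single fractions.
\<close>
lemma nn_integral_sticks_prod:
  fixes f :: "nat \<Rightarrow> real \<Rightarrow> ennreal"
  assumes "0 < \<theta>" "finite J" and f: "\<And>i. f i \<in> borel_measurable borel"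
  shows "(\<integral>\<^sup>+u. (\<Prod>i\<in>J. f i (u i)) \<partial>sticks \<theta>) = (\<Prod>i\<in>J. \<integral>\<^sup>+x. f i x \<partial>beta_one \<theta>)"
proof -
  interpret product_prob_space "\<lambda>_::nat. beta_one \<theta>" UNIV
    by (intro product_prob_spaceI prob_space_beta_one assms)
  have fb: "f i \<in> borel_measurable (beta_one \<theta>)" for i
    using f by (rule measurable_beta_one)
  have "(\<Prod>i\<in>J. \<integral>\<^sup>+x. f i x \<partial>beta_one \<theta>) = (\<integral>\<^sup>+u. (\<Prod>i\<in>J. f i (u i)) \<partial>(\<Pi>\<^sub>M i\<in>J. beta_one \<theta>))"
    using assms fb by (intro product_nn_integral_prod[symmetric]) auto
  also have "\<dots> = (\<integral>\<^sup>+u. (\<Prod>i\<in>J. f i (u i)) \<partial>distr (sticks \<theta>) (\<Pi>\<^sub>M i\<in>J. beta_one \<theta>) (\<lambda>x. restrict x J))"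
    unfolding sticks_def using assms by (subst distr_PiM_restrict_finite) auto
  also have "\<dots> = (\<integral>\<^sup>+u. (\<Prod>i\<in>J. f i (restrict u J i)) \<partial>sticks \<theta>)"
  proof (rule nn_integral_distr)
    show "(\<lambda>x. restrict x J) \<in> measurable (sticks \<theta>) (\<Pi>\<^sub>M i\<in>J. beta_one \<theta>)"
      unfolding sticks_def by (rule measurable_restrict_subset) simp
    have "(\<lambda>u. f i (u i)) \<in> borel_measurable (\<Pi>\<^sub>M i\<in>J. beta_one \<theta>)" if "i \<in> J" for i
      using measurable_compose[OF measurable_component_singleton[OF that, of "\<lambda>_. beta_one \<theta>"] fb[of i]] .
    then have "(\<lambda>u. \<Prod>i\<in>J. f i (u i)) \<in> borel_measurable (\<Pi>\<^sub>M i\<in>J. beta_one \<theta>)"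
      by (intro borel_measurable_prod_ennreal)
    then show "(\<lambda>u. \<Prod>i\<in>J. f i (u i)) \<in> borel_measurable (distr (sticks \<theta>) (\<Pi>\<^sub>M i\<in>J. beta_one \<theta>) (\<lambda>x. restrict x J))"
      by simp
  qed
  also have "\<dots> = (\<integral>\<^sup>+u. (\<Prod>i\<in>J. f i (u i)) \<partial>sticks \<theta>)"
    by (intro nn_integral_cong prod.cong) auto
  finally show ?thesis by simp
qed

lemma emeasure_le_nn_integral:
  assumes "A \<in> sets M" "\<And>u. u \<in> A \<Longrightarrow> 1 \<le> g u"
  shows "emeasure M A \<le> (\<integral>\<^sup>+u. g u \<partial>M)"
proof -
  have "emeasure M A = (\<integral>\<^sup>+u. indicator A u \<partial>M)" using assms by simp
  also have "\<dots> \<le> (\<integral>\<^sup>+u. g u \<partial>M)"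
    using assms(2) by (intro nn_integral_mono) (auto split: split_indicator)
  finally show ?thesis .
qed

text \<open>
  Markov's inequality for the first moment, applied to the mass that is left after the breaks in \<open>J\<close>.
\<close>
lemma prod_one_minus_gt_prob:
  assumes "0 < \<theta>" "0 < d" "finite J"
  shows "emeasure (sticks \<theta>) {u\<in>space (sticks \<theta>). d < (\<Prod>i\<in>J. 1 - u i)}
    \<le> ennreal ((\<theta> / (\<theta> + 1)) ^ card J / d)"
proof -
  let ?A = "{u\<in>space (sticks \<theta>). d < (\<Prod>i\<in>J. 1 - u i)}"
  have "emeasure (sticks \<theta>) ?A \<le> (\<integral>\<^sup>+u. ennreal (1 / d) * (\<Prod>i\<in>J. ennreal ((1 - u i) powr 1)) \<partial>sticks \<theta>)"
  proof (rule emeasure_le_nn_integral)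
    fix u assume u: "u \<in> ?A"
    then have fr: "u \<in> break_fractions" by (simp add: space_sticks)
    have "ennreal (1 / d) * (\<Prod>i\<in>J. ennreal ((1 - u i) powr 1)) = ennreal ((1 / d) * (\<Prod>i\<in>J. 1 - u i))"
    proof -
      have "(\<Prod>i\<in>J. ennreal ((1 - u i) powr 1)) = ennreal (\<Prod>i\<in>J. 1 - u i)"
        using fr by (simp add: prod_ennreal break_fractions_def less_imp_le)
      then show ?thesis
        using assms prod_one_minus_bounds(1)[OF fr, of J] by (simp only: ennreal_mult[symmetric] divide_nonneg_nonneg less_imp_le zero_le_one)
    qed
    moreover have "1 \<le> (1 / d) * (\<Prod>i\<in>J. 1 - u i)"
      using u assms by (simp add: field_simps)
    ultimately show "1 \<le> ennreal (1 / d) * (\<Prod>i\<in>J. ennreal ((1 - u i) powr 1))"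
      by simp
  qed measurable
  also have "\<dots> = ennreal (1 / d) * (\<integral>\<^sup>+u. (\<Prod>i\<in>J. ennreal ((1 - u i) powr 1)) \<partial>sticks \<theta>)"
    by (rule nn_integral_cmult) measurable
  also have "(\<integral>\<^sup>+u. (\<Prod>i\<in>J. ennreal ((1 - u i) powr 1)) \<partial>sticks \<theta>) = (\<Prod>i\<in>J. ennreal (\<theta> / (\<theta> + 1)))"
    using assms by (subst nn_integral_sticks_prod) (auto simp del: powr_one' simp: beta_one_moment)
  also have "ennreal (1 / d) * \<dots> = ennreal ((\<theta> / (\<theta> + 1)) ^ card J / d)"
    using assms by (simp add: ennreal_power divide_inverse mult.commute flip: ennreal_mult)
  finally show ?thesis .
qed

text \<open>
  Markov's inequality for the moment of order \<open>1 - \<theta>\<close>. The order \<open>- \<theta>\<close>, which would give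
  the exact exponent, has infinite moment; the loss is a factor \<open>\<theta>\<^bsup>card J\<^esup> / y\<close>.
\<close>
lemma prod_one_minus_less_prob:
  assumes "1 \<le> \<theta>" "0 < y" "finite J"
  shows "emeasure (sticks \<theta>) {u\<in>space (sticks \<theta>). (\<Prod>i\<in>J. 1 - u i) < y}
    \<le> ennreal (\<theta> ^ card J * y powr (\<theta> - 1))"
proof -
  let ?A = "{u\<in>space (sticks \<theta>). (\<Prod>i\<in>J. 1 - u i) < y}"
  have "emeasure (sticks \<theta>) ?A \<le>
      (\<integral>\<^sup>+u. ennreal (y powr (\<theta> - 1)) * (\<Prod>i\<in>J. ennreal ((1 - u i) powr (1 - \<theta>))) \<partial>sticks \<theta>)"
  proof (rule emeasure_le_nn_integral)
    fix u assume u: "u \<in> ?A"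
    then have fr: "u \<in> break_fractions" by (simp add: space_sticks)
    have pos: "0 < (\<Prod>i\<in>J. 1 - u i)" by (rule prod_one_minus_bounds[OF fr])
    have "ennreal (y powr (\<theta> - 1)) * (\<Prod>i\<in>J. ennreal ((1 - u i) powr (1 - \<theta>))) =
        ennreal (y powr (\<theta> - 1) * (\<Prod>i\<in>J. (1 - u i) powr (1 - \<theta>)))"
      by (simp add: prod_ennreal ennreal_mult prod_nonneg)
    also have "(\<Prod>i\<in>J. (1 - u i) powr (1 - \<theta>)) = (\<Prod>i\<in>J. 1 - u i) powr (1 - \<theta>)"
      using fr by (subst prod_powr_distrib) (auto simp: break_fractions_def less_imp_le)
    also have "y powr (\<theta> - 1) * (\<Prod>i\<in>J. 1 - u i) powr (1 - \<theta>) = (y / (\<Prod>i\<in>J. 1 - u i)) powr (\<theta> - 1)"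
      using assms pos by (simp add: powr_divide powr_minus_divide[of _ "\<theta> - 1", simplified])
    finally have eq: "ennreal (y powr (\<theta> - 1)) * (\<Prod>i\<in>J. ennreal ((1 - u i) powr (1 - \<theta>))) =
        ennreal ((y / (\<Prod>i\<in>J. 1 - u i)) powr (\<theta> - 1))" .
    have "1 \<le> (y / (\<Prod>i\<in>J. 1 - u i)) powr (\<theta> - 1)"
      using u pos assms by (intro ge_one_powr_ge_zero) auto
    then show "1 \<le> ennreal (y powr (\<theta> - 1)) * (\<Prod>i\<in>J. ennreal ((1 - u i) powr (1 - \<theta>)))"
      unfolding eq by simp
  qed measurable
  also have "\<dots> = ennreal (y powr (\<theta> - 1)) * (\<integral>\<^sup>+u. (\<Prod>i\<in>J. ennreal ((1 - u i) powr (1 - \<theta>))) \<partial>sticks \<theta>)"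
    by (rule nn_integral_cmult) measurable
  also have "(\<integral>\<^sup>+u. (\<Prod>i\<in>J. ennreal ((1 - u i) powr (1 - \<theta>))) \<partial>sticks \<theta>) = (\<Prod>i\<in>J. ennreal \<theta>)"
    using assms beta_one_moment[of \<theta> "1 - \<theta>"] by (subst nn_integral_sticks_prod) auto
  also have "ennreal (y powr (\<theta> - 1)) * \<dots> = ennreal (\<theta> ^ card J * y powr (\<theta> - 1))"
    using assms by (simp add: ennreal_power mult.commute flip: ennreal_mult)
  finally show ?thesis .
qed

lemma measurable_ranked:
  "(\<lambda>u. descending_rearrangement (stick_breaking u)) \<in> measurable (sticks \<theta>) (restrict_space borel nabla_bar)"
proof (rule measurable_restrict_space2)
  show "(\<lambda>u. descending_rearrangement (stick_breaking u)) \<in> space (sticks \<theta>) \<rightarrow> nabla_bar"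
    by (auto simp: space_sticks ranked_stick_breaking_in_nabla_bar)
  show "(\<lambda>u. descending_rearrangement (stick_breaking u)) \<in> borel_measurable (sticks \<theta>)"
  proof (rule measurable_coordinatewise_then_product)
    fix k
    show "(\<lambda>u. descending_rearrangement (stick_breaking u) k) \<in> borel_measurable (sticks \<theta>)"
      unfolding borel_measurable_iff_greater
    proof
      fix t :: real
      let ?\<B> = "{B :: nat set. finite B \<and> card B = Suc k}"
      have "{u\<in>space (sticks \<theta>). t < descending_rearrangement (stick_breaking u) k} =
          (\<Union>B\<in>?\<B>. {u\<in>space (sticks \<theta>). \<forall>i\<in>B. t < stick_breaking u i})"
        using ranked_greater_iff by (auto simp: space_sticks)
      also have "\<dots> \<in> sets (sticks \<theta>)"
      proof (rule sets.countable_UN'')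
        show "countable ?\<B>"
          by (rule countable_subset[OF _ countable_Collect_finite]) auto
        show "{u\<in>space (sticks \<theta>). \<forall>i\<in>B. t < stick_breaking u i} \<in> sets (sticks \<theta>)" if "B \<in> ?\<B>" for B
          using that by (intro sets.sets_Collect_finite_All) auto
      qed
      finally show "{u\<in>space (sticks \<theta>). t < descending_rearrangement (stick_breaking u) k} \<in> sets (sticks \<theta>)" .
    qed
  qed
qed

lemma PD_sticks: "PD \<theta> = distr (sticks \<theta>) (restrict_space borel nabla_bar)
    (\<lambda>u. descending_rearrangement (stick_breaking u))"
  by (simp add: PD_def sticks_def)

lemma prob_space_PD: "0 < \<theta> \<Longrightarrow> prob_space (PD \<theta>)"
  unfolding PD_sticks by (intro prob_space.prob_space_distr prob_space_sticks measurable_ranked)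

lemma sets_PD: "sets (PD \<theta>) = sets (restrict_space borel nabla_bar)"
  by (simp add: PD_def)

lemma measure_PD:
  assumes "open V"
  shows "measure (PD \<theta>) (V \<inter> nabla_bar) =
    measure (sticks \<theta>) {u\<in>space (sticks \<theta>). descending_rearrangement (stick_breaking u) \<in> V}"
proof -
  have "V \<inter> nabla_bar \<in> sets (restrict_space borel nabla_bar)"
    by (rule sets_restrict_open_Int[OF refl assms])
  then have "measure (PD \<theta>) (V \<inter> nabla_bar) = measure (sticks \<theta>)
      ((\<lambda>u. descending_rearrangement (stick_breaking u)) -` (V \<inter> nabla_bar) \<inter> space (sticks \<theta>))"
    unfolding PD_sticks by (intro measure_distr measurable_ranked)
  also have "(\<lambda>u. descending_rearrangement (stick_breaking u)) -` (V \<inter> nabla_bar) \<inter> space (sticks \<theta>) =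
      {u\<in>space (sticks \<theta>). descending_rearrangement (stick_breaking u) \<in> V}"
    by (auto simp: space_sticks ranked_stick_breaking_in_nabla_bar)
  finally show ?thesis .
qed

section \<open>The two probability estimates\<close>

text \<open>
  The index \<open>N\<close> is free. It has to be large enough to make the first summand negligible, but
  only polynomial in \<open>\<theta>\<close>, so that the second one keeps the rate \<open>- ln (1 - t + d)\<close>.
\<close>
lemma top_sum_prob_le:
  assumes "1 \<le> \<theta>" "0 < d" "0 < 1 - t + d"
  shows "measure (sticks \<theta>) {u\<in>space (sticks \<theta>). t < (\<Sum>k<n. descending_rearrangement (stick_breaking u) k)}
    \<le> (\<theta> / (\<theta> + 1)) ^ N / d + (real N + 1) ^ n * (\<theta> ^ n * (1 - t + d) powr (\<theta> - 1))"
proof -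
  interpret prob_space "sticks \<theta>" using assms by (intro prob_space_sticks) simp
  define y where "y = 1 - t + d"
  have "0 < y" using assms by (simp add: y_def)
  define \<F> where "\<F> = {..<n} \<rightarrow>\<^sub>E {..N}"
  let ?B = "{u\<in>space (sticks \<theta>). d < (\<Prod>i<N. 1 - u i)}"
  define C where "C f = {u\<in>space (sticks \<theta>). (\<Prod>i\<in>f ` {..<n}. 1 - u i) < y}" for f :: "nat \<Rightarrow> nat"
  have fin: "finite \<F>" "card \<F> = (N + 1) ^ n"
    by (auto simp: \<F>_def card_PiE intro!: finite_PiE)
  have mB: "?B \<in> sets (sticks \<theta>)" by measurable
  have mC: "C f \<in> sets (sticks \<theta>)" for f unfolding C_def by measurable
  have pB: "prob ?B \<le> (\<theta> / (\<theta> + 1)) ^ N / d"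
    using prod_one_minus_gt_prob[of \<theta> d "{..<N}"] assms
    by (simp add: emeasure_eq_measure ennreal_le_iff)
  have pC: "prob (C f) \<le> \<theta> ^ n * y powr (\<theta> - 1)" for f
  proof -
    have "prob (C f) \<le> \<theta> ^ card (f ` {..<n}) * y powr (\<theta> - 1)"
      using prod_one_minus_less_prob[of \<theta> y "f ` {..<n}"] assms \<open>0 < y\<close>
      by (simp add: emeasure_eq_measure ennreal_le_iff C_def)
    also have "\<dots> \<le> \<theta> ^ n * y powr (\<theta> - 1)"
      using assms card_image_le[of "{..<n}" f] by (intro mult_right_mono power_increasing) auto
    finally show ?thesis .
  qed
  have "{u\<in>space (sticks \<theta>). t < (\<Sum>k<n. descending_rearrangement (stick_breaking u) k)} \<subseteq> ?B \<union> (\<Union>f\<in>\<F>. C f)"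
  proof
    fix u assume "u \<in> {u\<in>space (sticks \<theta>). t < (\<Sum>k<n. descending_rearrangement (stick_breaking u) k)}"
    then have u: "u \<in> break_fractions" "t < (\<Sum>k<n. descending_rearrangement (stick_breaking u) k)"
      by (auto simp: space_sticks)
    from top_sum_greater_cases[OF u, of d N] u(1)
    show "u \<in> ?B \<union> (\<Union>f\<in>\<F>. C f)" unfolding C_def \<F>_def y_def space_sticks by blast
  qed
  then have "prob {u\<in>space (sticks \<theta>). t < (\<Sum>k<n. descending_rearrangement (stick_breaking u) k)}
      \<le> prob (?B \<union> (\<Union>f\<in>\<F>. C f))"
    using mB mC fin by (intro finite_measure_mono sets.Un sets.finite_UN) auto
  also have "\<dots> \<le> prob ?B + prob (\<Union>f\<in>\<F>. C f)"
    using mB mC fin by (intro measure_Un_le sets.finite_UN) auto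
  also have "prob (\<Union>f\<in>\<F>. C f) \<le> (\<Sum>f\<in>\<F>. prob (C f))"
    using mC fin by (intro finite_measure_subadditive_finite) auto
  also have "(\<Sum>f\<in>\<F>. prob (C f)) \<le> (\<Sum>f\<in>\<F>. \<theta> ^ n * y powr (\<theta> - 1))"
    by (intro sum_mono pC)
  also have "\<dots> = (real N + 1) ^ n * (\<theta> ^ n * y powr (\<theta> - 1))"
    by (simp add: fin add.commute)
  finally show ?thesis using pB by (simp add: y_def)
qed

text \<open>
  The pieces after the first \<open>n\<close> are bounded by those of a stick-breaking sequence that starts at
  the index \<open>n\<close> and is independent of the box. The squares of its pieces have expected sum
  \<open>1 / (\<theta> + 1)\<close>, so all of them are at most \<open>\<epsilon>\<close> up to probability
  \<open>1 / (\<epsilon>\<^sup>2 (\<theta> + 1))\<close>.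
\<close>
lemma box_prob_ge:
  assumes "1 \<le> \<theta>" and w: "\<And>k. k < n \<Longrightarrow> \<gamma> < w k \<and> w k < 1" and "0 < \<gamma>" "0 < \<epsilon>"
  shows "(1 - 1 / (\<epsilon>\<^sup>2 * (\<theta> + 1))) * (\<Prod>k<n. measure (beta_one \<theta>) {w k - \<gamma><..<w k})
    \<le> measure (sticks \<theta>) {u\<in>space (sticks \<theta>). (\<forall>k<n. w k - \<gamma> < u k \<and> u k < w k) \<and>
        (\<forall>i\<ge>n. stick_breaking u i \<le> \<epsilon>)}"
proof -
  have \<theta>: "0 < \<theta>" using assms by simp
  interpret prob_space "sticks \<theta>" by (rule prob_space_sticks[OF \<theta>])
  interpret B: prob_space "beta_one \<theta>" by (rule prob_space_beta_one[OF \<theta>])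
  define I where "I k = {w k - \<gamma><..<w k}" for k
  define b where "b = (\<Prod>k<n. measure (beta_one \<theta>) (I k))"
  define A where "A = {u\<in>space (sticks \<theta>). \<forall>k<n. u k \<in> I k}"
  define r where "r = \<theta> / (\<theta> + 2)"
  define m where "m = 2 / ((\<theta> + 1) * (\<theta> + 2))"
  have r: "0 \<le> r" "r < 1" using \<theta> by (auto simp: r_def)
  have "0 \<le> m" using \<theta> by (simp add: m_def)
  have "0 \<le> b" by (auto simp: b_def intro!: prod_nonneg)
  have Ib: "(\<integral>\<^sup>+x. indicator (I k) x \<partial>beta_one \<theta>) = ennreal (measure (beta_one \<theta>) (I k))" if "k < n" for k
  proof -
    have "I k \<in> sets (beta_one \<theta>)"
      using w[OF that] by (auto simp: I_def beta_one_def sets_restrict_space_iff)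
    then show ?thesis by (simp add: B.emeasure_eq_measure)
  qed
  have mI: "indicator (I k) \<in> borel_measurable (borel :: real measure)" for k
    by (simp add: I_def)
  have mA: "A \<in> sets (sticks \<theta>)" unfolding A_def I_def by measurable
  have pA: "prob A = b"
  proof -
    have "emeasure (sticks \<theta>) A = (\<integral>\<^sup>+u. (\<Prod>k<n. indicator (I k) (u k)) \<partial>sticks \<theta>)"
    proof -
      have "(\<integral>\<^sup>+u. (\<Prod>k<n. indicator (I k) (u k)) \<partial>sticks \<theta>) = (\<integral>\<^sup>+u. indicator A u \<partial>sticks \<theta>)"
        by (intro nn_integral_cong) (auto simp: A_def indicator_def)
      then show ?thesis using mA by simp
    qed
    also have "\<dots> = (\<Prod>k<n. \<integral>\<^sup>+x. indicator (I k) x \<partial>beta_one \<theta>)"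
      using \<theta> by (intro nn_integral_sticks_prod mI) auto
    also have "\<dots> = (\<Prod>k<n. ennreal (measure (beta_one \<theta>) (I k)))"
      by (intro prod.cong refl Ib) simp
    also have "\<dots> = ennreal b"
      by (simp add: b_def prod_ennreal)
    finally show ?thesis using \<open>0 \<le> b\<close> by (simp add: emeasure_eq_measure)
  qed
  define D where "D j = {u\<in>space (sticks \<theta>). u \<in> A \<and> \<epsilon> < stick_breaking u (n + j)}" for j
  have mD: "D j \<in> sets (sticks \<theta>)" for j unfolding D_def using mA by measurable
  have pD: "prob (D j) \<le> b * m / \<epsilon>\<^sup>2 * r ^ j" for j
  proof -
    \<comment> \<open>The product of these functions is the indicator of the box times the square of the piece
      \<open>n + j\<close> of the sequence restarted at \<open>n\<close>; it dominates \<open>\<epsilon>\<^sup>2\<close> on \<open>D j\<close>.\<close>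
    define f where "f i = (if i < n then indicator (I i) else if i < n + j then (\<lambda>x. ennreal ((1 - x) powr 2))
        else (\<lambda>x. ennreal (x\<^sup>2)))" for i
    have mf: "f i \<in> borel_measurable borel" for i
      using mI by (auto simp: f_def)
    have split: "(\<Prod>i<Suc (n + j). g i) = (\<Prod>i<n. g i) * (\<Prod>i\<in>{n..<n + j}. g i) * g (n + j)" for g :: "nat \<Rightarrow> ennreal"
    proof -
      have "(\<Prod>i<n + j. g i) = (\<Prod>i<n. g i) * (\<Prod>i\<in>{n..<n + j}. g i)"
        by (metis add.commute le_add2 lessThan_atLeast0 prod.atLeastLessThan_concat zero_le)
      then show ?thesis by simp
    qed
    have "emeasure (sticks \<theta>) (D j) \<le> (\<integral>\<^sup>+u. ennreal (1 / \<epsilon>\<^sup>2) * (\<Prod>i<Suc (n + j). f i (u i)) \<partial>sticks \<theta>)"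
    proof (rule emeasure_le_nn_integral[OF mD])
      fix u assume "u \<in> D j"
      then have u: "u \<in> break_fractions" "u \<in> A" "\<epsilon> < stick_breaking u (n + j)"
        by (auto simp: D_def space_sticks)
      define z where "z = (\<Prod>i\<in>{n..<n + j}. 1 - u i) * u (n + j)"
      have "0 \<le> z" using u(1) unfolding z_def
        by (intro mult_nonneg_nonneg prod_nonneg) (auto simp: break_fractions_def less_imp_le)
      have "stick_breaking u (n + j) \<le> z"
        unfolding stick_breaking_def z_def using u(1)
        by (intro mult_right_mono prod_one_minus_antimono) (auto simp: break_fractions_def less_imp_le)
      then have "\<epsilon>\<^sup>2 \<le> z\<^sup>2" using u(3) \<open>0 < \<epsilon>\<close> by (intro power_mono) auto
      then have "1 \<le> 1 / \<epsilon>\<^sup>2 * z\<^sup>2" using \<open>0 < \<epsilon>\<close> by (simp add: field_simps)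
      have "(\<Prod>i<n. f i (u i)) = 1"
        using u(2) by (intro prod.neutral) (auto simp: f_def A_def)
      moreover have "(\<Prod>i\<in>{n..<n + j}. f i (u i)) = ennreal (\<Prod>i\<in>{n..<n + j}. (1 - u i)\<^sup>2)"
        using u(1) by (subst prod_ennreal[symmetric])
          (auto simp: f_def break_fractions_def powr_numeral less_imp_le intro!: prod.cong arg_cong[where f = ennreal])
      moreover have "f (n + j) (u (n + j)) = ennreal ((u (n + j))\<^sup>2)"
        by (simp add: f_def)
      ultimately have "(\<Prod>i<Suc (n + j). f i (u i)) = ennreal (z\<^sup>2)"
        unfolding split by (simp add: z_def power_mult_distrib prod_power_distrib ennreal_mult prod_nonneg)
      then have "ennreal (1 / \<epsilon>\<^sup>2) * (\<Prod>i<Suc (n + j). f i (u i)) = ennreal (1 / \<epsilon>\<^sup>2 * z\<^sup>2)"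
        by (simp only: ennreal_mult[symmetric] zero_le_power2 zero_le_divide_1_iff)
      also have "\<dots> \<ge> 1" using \<open>1 \<le> 1 / \<epsilon>\<^sup>2 * z\<^sup>2\<close> by simp
      finally show "1 \<le> ennreal (1 / \<epsilon>\<^sup>2) * (\<Prod>i<Suc (n + j). f i (u i))" .
    qed
    also have "\<dots> = ennreal (1 / \<epsilon>\<^sup>2) * (\<integral>\<^sup>+u. (\<Prod>i<Suc (n + j). f i (u i)) \<partial>sticks \<theta>)"
      by (intro nn_integral_cmult borel_measurable_prod_ennreal measurable_sticks_coordinate mf)
    also have "(\<integral>\<^sup>+u. (\<Prod>i<Suc (n + j). f i (u i)) \<partial>sticks \<theta>) = (\<Prod>i<Suc (n + j). \<integral>\<^sup>+x. f i x \<partial>beta_one \<theta>)"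
      using \<theta> mf by (intro nn_integral_sticks_prod) auto
    also have "\<dots> = ennreal b * ennreal (r ^ j) * ennreal m"
    proof -
      have "(\<Prod>i<n. \<integral>\<^sup>+x. f i x \<partial>beta_one \<theta>) = (\<Prod>i<n. ennreal (measure (beta_one \<theta>) (I i)))"
        by (intro prod.cong refl) (simp add: f_def Ib)
      also have "\<dots> = ennreal b" by (simp add: b_def prod_ennreal)
      finally have 1: "(\<Prod>i<n. \<integral>\<^sup>+x. f i x \<partial>beta_one \<theta>) = ennreal b" .
      have "(\<Prod>i\<in>{n..<n + j}. \<integral>\<^sup>+x. f i x \<partial>beta_one \<theta>) = (\<Prod>i\<in>{n..<n + j}. ennreal r)"
        using beta_one_moment[of \<theta> 2] \<theta> by (intro prod.cong refl) (simp add: f_def r_def)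
      also have "\<dots> = ennreal (r ^ j)" using r by (simp add: ennreal_power)
      finally have 2: "(\<Prod>i\<in>{n..<n + j}. \<integral>\<^sup>+x. f i x \<partial>beta_one \<theta>) = ennreal (r ^ j)" .
      have 3: "(\<integral>\<^sup>+x. f (n + j) x \<partial>beta_one \<theta>) = ennreal m"
        using beta_one_second_moment[OF \<theta>] by (simp add: f_def m_def)
      show ?thesis unfolding split 1 2 3 ..
    qed
    also have "ennreal (1 / \<epsilon>\<^sup>2) * \<dots> = ennreal (b * m / \<epsilon>\<^sup>2 * r ^ j)"
      using \<open>0 \<le> b\<close> \<open>0 \<le> m\<close> r by (simp add: mult_ac flip: ennreal_mult)
    finally show ?thesis
      using \<open>0 \<le> b\<close> \<open>0 \<le> m\<close> r by (simp add: emeasure_eq_measure ennreal_le_iff)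
  qed
  have sums: "(\<lambda>j. b * m / \<epsilon>\<^sup>2 * r ^ j) sums (b * m / \<epsilon>\<^sup>2 * (1 / (1 - r)))"
    using r by (intro sums_mult geometric_sums) simp
  have summ: "summable (\<lambda>j. prob (D j))"
    using pD by (intro summable_comparison_test'[OF sums_summable[OF sums]]) auto
  have "prob (\<Union>j. D j) \<le> (\<Sum>j. prob (D j))"
    using mD summ by (intro finite_measure_subadditive_countably) auto
  also have "\<dots> \<le> (\<Sum>j. b * m / \<epsilon>\<^sup>2 * r ^ j)"
    by (intro suminf_le pD summ sums_summable[OF sums])
  also have "\<dots> = b * m / \<epsilon>\<^sup>2 * (1 / (1 - r))" by (rule sums_unique[OF sums, symmetric])
  also have "\<dots> = b * (m / (1 - r)) / \<epsilon>\<^sup>2" by simp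
  also have "m / (1 - r) = 1 / (\<theta> + 1)"
  proof -
    have eq: "1 - r = 2 / (\<theta> + 2)" using \<theta> by (simp add: r_def field_simps)
    show ?thesis unfolding m_def eq using \<theta> by (simp add: divide_simps)
  qed
  also have "b * (1 / (\<theta> + 1)) / \<epsilon>\<^sup>2 = b * (1 / (\<epsilon>\<^sup>2 * (\<theta> + 1)))" by simp
  finally have U: "prob (\<Union>j. D j) \<le> b * (1 / (\<epsilon>\<^sup>2 * (\<theta> + 1)))" .
  have "(1 - 1 / (\<epsilon>\<^sup>2 * (\<theta> + 1))) * b = b - b * (1 / (\<epsilon>\<^sup>2 * (\<theta> + 1)))"
    using left_diff_distrib[of 1 "1 / (\<epsilon>\<^sup>2 * (\<theta> + 1))" b] by (simp add: mult.commute)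
  also have "\<dots> \<le> prob A - prob (\<Union>j. D j)" using U pA by simp
  also have "\<dots> = prob (A - (\<Union>j. D j))"
    using mA mD by (intro finite_measure_Diff[symmetric]) (auto simp: D_def)
  also have "A - (\<Union>j. D j) = {u\<in>space (sticks \<theta>). (\<forall>k<n. w k - \<gamma> < u k \<and> u k < w k) \<and>
        (\<forall>i\<ge>n. stick_breaking u i \<le> \<epsilon>)}"
  proof (intro set_eqI iffI)
    fix u assume u: "u \<in> A - (\<Union>j. D j)"
    have "stick_breaking u i \<le> \<epsilon>" if "n \<le> i" for i
    proof -
      have "u \<notin> D (i - n)" using u by blast
      then show ?thesis using u that by (auto simp: D_def A_def)
    qed
    then show "u \<in> {u\<in>space (sticks \<theta>). (\<forall>k<n. w k - \<gamma> < u k \<and> u k < w k) \<and>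
        (\<forall>i\<ge>n. stick_breaking u i \<le> \<epsilon>)}"
      using u by (auto simp: A_def I_def)
  next
    fix u assume "u \<in> {u\<in>space (sticks \<theta>). (\<forall>k<n. w k - \<gamma> < u k \<and> u k < w k) \<and>
        (\<forall>i\<ge>n. stick_breaking u i \<le> \<epsilon>)}"
    then show "u \<in> A - (\<Union>j. D j)"
      by (auto simp: A_def I_def D_def not_less)
  qed
  finally show ?thesis by (simp add: b_def I_def)
qed

lemma upper_bound_asymptotics:
  fixes a \<beta> d :: real and n :: nat
  assumes "\<beta> > 0" "d > 0"
  shows "((\<lambda>\<theta>. exp (a * \<theta>) * (exp (- (\<theta> ^ 3 / (\<theta> + 1))) / d +
      (\<theta> ^ 3 + 2) ^ n * (\<theta> ^ n * exp (- ((a + \<beta>) * (\<theta> - 1)))))) \<longlongrightarrow> 0) at_top"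
proof -
  have 1: "((\<lambda>\<theta>. exp (a * \<theta> - \<theta> ^ 3 / (\<theta> + 1)) / d) \<longlongrightarrow> 0) at_top"
    using assms by real_asymp
  have 2: "((\<lambda>\<theta>. (\<theta> ^ 3 + 2) ^ n * (\<theta> ^ n * exp (- (\<beta> * \<theta>))) * exp (a + \<beta>)) \<longlongrightarrow> 0) at_top"
    using assms by real_asymp
  have "exp (a * \<theta> - \<theta> ^ 3 / (\<theta> + 1)) / d + (\<theta> ^ 3 + 2) ^ n * (\<theta> ^ n * exp (- (\<beta> * \<theta>))) * exp (a + \<beta>)
      = exp (a * \<theta>) * (exp (- (\<theta> ^ 3 / (\<theta> + 1))) / d +
      (\<theta> ^ 3 + 2) ^ n * (\<theta> ^ n * exp (- ((a + \<beta>) * (\<theta> - 1)))))" for \<theta>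
  proof -
    have "exp (a * \<theta> - \<theta> ^ 3 / (\<theta> + 1)) = exp (a * \<theta>) * exp (- (\<theta> ^ 3 / (\<theta> + 1)))"
      by (simp flip: exp_add)
    moreover have "exp (a * \<theta>) * exp (- ((a + \<beta>) * (\<theta> - 1))) = exp (- (\<beta> * \<theta>)) * exp (a + \<beta>)"
      by (simp add: algebra_simps flip: exp_add)
    ultimately show ?thesis by (simp add: distrib_left mult_ac)
  qed
  then show ?thesis using tendsto_add[OF 1 2] by simp
qed

section \<open>Local rate of the Poisson--Dirichlet family and its tilts\<close>

lemma rate_S_less_iff:
  assumes "p \<in> nabla_bar"
  shows "ereal a < rate_S p \<longleftrightarrow> 1 - exp (- a) < (\<Sum>k. p k)"
    and "rate_S p < ereal a \<longleftrightarrow> (\<Sum>k. p k) < 1 - exp (- a)"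
proof -
  let ?s = "\<Sum>k. p k"
  have 1: "a < - ln (1 - ?s) \<longleftrightarrow> 1 - exp (- a) < ?s" if "?s < 1"
    using ln_less_cancel_iff[of "1 - ?s" "exp (- a)"] that by auto
  have 2: "- ln (1 - ?s) < a \<longleftrightarrow> ?s < 1 - exp (- a)" if "?s < 1"
    using ln_less_cancel_iff[of "exp (- a)" "1 - ?s"] that by auto
  have [simp]: "ln (1 / (1 - ?s)) = - ln (1 - ?s)" if "?s < 1"
    using that by (simp add: ln_div)
  show "ereal a < rate_S p \<longleftrightarrow> 1 - exp (- a) < ?s"
  proof (cases "?s < 1")
    case False
    then have "1 - exp (- a) < ?s" using exp_gt_zero[of "- a"] by linarith
    then show ?thesis using False by (simp add: rate_S_def)
  qed (simp add: rate_S_def 1)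
  show "rate_S p < ereal a \<longleftrightarrow> ?s < 1 - exp (- a)"
  proof (cases "?s < 1")
    case False
    then have "\<not> ?s < 1 - exp (- a)" using exp_gt_zero[of "- a"] by linarith
    then show ?thesis using False by (simp add: rate_S_def)
  qed (simp add: rate_S_def 2)
qed

text \<open>
  Any \<open>a\<close> below \<open>rate_S p\<close> satisfies \<open>1 - exp (- a) < \<Sum>k. p k\<close>, even when the sum is \<open>1\<close>
  and the rate infinite. So finitely many entries of \<open>p\<close> already have sum \<open>t > 1 - exp (- a)\<close>.
\<close>
lemma PD_local_upper:
  assumes p: "p \<in> nabla_bar" and a: "ereal a < rate_S p"
  shows "\<exists>V. open V \<and> p \<in> V \<and> (\<forall>\<^sub>F \<theta> in at_top. measure (PD \<theta>) (V \<inter> nabla_bar) \<le> exp (- (a * \<theta>)))"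
proof -
  have s: "1 - exp (- a) < (\<Sum>k. p k)" "(\<Sum>k. p k) \<le> 1" "summable p"
    using rate_S_less_iff(1)[OF p, of a] a p by (auto simp: nabla_bar_def)
  obtain t where t: "1 - exp (- a) < t" "t < (\<Sum>k. p k)" using dense[OF s(1)] by blast
  have "(\<lambda>n. \<Sum>k<n. p k) \<longlonglongrightarrow> (\<Sum>k. p k)" using summable_LIMSEQ[OF s(3)] .
  then have "\<forall>\<^sub>F n in sequentially. t < (\<Sum>k<n. p k)" using t(2) by (rule order_tendstoD)
  then obtain n where n: "t < (\<Sum>k<n. p k)" by (auto dest: eventually_happens)
  \<comment> \<open>Half of the gap, so that the base \<open>y = 1 - t + d\<close> of the exponential bound stays below \<open>exp (- a)\<close>.\<close>
  define d where "d = (t - (1 - exp (- a))) / 2"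
  define y where "y = 1 - t + d"
  have d: "d > 0" using t by (simp add: d_def)
  have y: "0 < y" "y < exp (- a)" using t s d by (auto simp: y_def d_def field_simps)
  define \<beta> where "\<beta> = - ln y - a"
  have \<beta>: "\<beta> > 0" using y ln_less_cancel_iff[of y "exp (- a)"] by (simp add: \<beta>_def)
  have yp: "y powr x = exp (- ((a + \<beta>) * x))" for x
    using y by (simp add: powr_def \<beta>_def mult.commute)
  define V where "V = {q :: nat \<Rightarrow> real. t < (\<Sum>k<n. q k)}"
  have "open V"
    unfolding V_def by (intro open_Collect_less continuous_intros continuous_on_product_coordinates)
  moreover have "p \<in> V" using n by (simp add: V_def)
  moreover have "\<forall>\<^sub>F \<theta> in at_top. measure (PD \<theta>) (V \<inter> nabla_bar) \<le> exp (- (a * \<theta>))"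
  proof -
    have "\<forall>\<^sub>F \<theta> in at_top. exp (a * \<theta>) * (exp (- (\<theta> ^ 3 / (\<theta> + 1))) / d +
      (\<theta> ^ 3 + 2) ^ n * (\<theta> ^ n * exp (- ((a + \<beta>) * (\<theta> - 1))))) < 1"
      using upper_bound_asymptotics[OF \<beta> d] by (rule order_tendstoD) simp
    then show ?thesis using eventually_ge_at_top[of 1]
    proof eventually_elim
      case (elim \<theta>)
      \<comment> \<open>Any power above \<open>2\<close> makes \<open>(\<theta> / (\<theta> + 1)) ^ N \<le> exp (- N / (\<theta> + 1))\<close> super-exponentially small.\<close>
      define N where "N = nat \<lceil>\<theta> ^ 3\<rceil>"
      have N: "\<theta> ^ 3 \<le> real N" "real N \<le> \<theta> ^ 3 + 1"
        using elim by (auto simp: N_def)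
      have "\<theta> / (\<theta> + 1) = 1 + - (1 / (\<theta> + 1))" using elim by (simp add: field_simps)
      also have "\<dots> \<le> exp (- (1 / (\<theta> + 1)))" by (rule exp_ge_add_one_self)
      finally have "(\<theta> / (\<theta> + 1)) ^ N \<le> exp (- (1 / (\<theta> + 1))) ^ N"
        using elim by (intro power_mono) auto
      also have "\<dots> = exp (- (real N / (\<theta> + 1)))" by (simp flip: exp_of_nat_mult)
      also have "\<dots> \<le> exp (- (\<theta> ^ 3 / (\<theta> + 1)))"
        using N elim by (auto intro!: divide_right_mono)
      finally have 1: "(\<theta> / (\<theta> + 1)) ^ N / d \<le> exp (- (\<theta> ^ 3 / (\<theta> + 1))) / d"
        using d by (intro divide_right_mono) auto
      have 2: "(real N + 1) ^ n * (\<theta> ^ n * y powr (\<theta> - 1)) \<le>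
          (\<theta> ^ 3 + 2) ^ n * (\<theta> ^ n * exp (- ((a + \<beta>) * (\<theta> - 1))))"
        unfolding yp using N elim by (intro mult_right_mono power_mono) auto
      have "measure (PD \<theta>) (V \<inter> nabla_bar) =
          measure (sticks \<theta>) {u\<in>space (sticks \<theta>). t < (\<Sum>k<n. descending_rearrangement (stick_breaking u) k)}"
        using measure_PD[OF \<open>open V\<close>] by (simp add: V_def)
      also have "\<dots> \<le> (\<theta> / (\<theta> + 1)) ^ N / d + (real N + 1) ^ n * (\<theta> ^ n * y powr (\<theta> - 1))"
        unfolding y_def using elim d y by (intro top_sum_prob_le) (auto simp: y_def)
      also have "\<dots> \<le> exp (- (\<theta> ^ 3 / (\<theta> + 1))) / d +
          (\<theta> ^ 3 + 2) ^ n * (\<theta> ^ n * exp (- ((a + \<beta>) * (\<theta> - 1))))"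
        using 1 2 by (rule add_mono)
      also have "\<dots> = exp (- (a * \<theta>)) * (exp (a * \<theta>) * (exp (- (\<theta> ^ 3 / (\<theta> + 1))) / d +
          (\<theta> ^ 3 + 2) ^ n * (\<theta> ^ n * exp (- ((a + \<beta>) * (\<theta> - 1))))))"
        by (simp flip: exp_add mult.assoc)
      also have "\<dots> \<le> exp (- (a * \<theta>)) * 1"
        using elim(1) by (intro mult_left_mono) auto
      finally show ?case by simp
    qed
  qed
  ultimately show ?thesis by blast
qed

text \<open>
  The prescribed pieces are \<open>q k = p k + \<eta>\<close> rather than \<open>p k\<close>, because the fractions \<open>w k\<close>
  must be positive. The boxes lie to the left of \<open>w k\<close>, where the beta density is at least its
  value at \<open>w k\<close>.
\<close>
lemma PD_local_lower:
  assumes p: "p \<in> nabla_bar" and a: "rate_S p < ereal a" and V: "open V" "p \<in> V"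
  shows "\<forall>\<^sub>F \<theta> in at_top. exp (- (a * \<theta>)) \<le> measure (PD \<theta>) (V \<inter> nabla_bar)"
proof -
  define s where "s = (\<Sum>k. p k)"
  have s: "s < 1 - exp (- a)" "summable p" and p0: "\<And>k. 0 \<le> p k"
    using rate_S_less_iff(2)[OF p, of a] a p by (auto simp: nabla_bar_def s_def)
  obtain n \<epsilon> where \<epsilon>: "\<epsilon> > 0" and box: "\<And>q. (\<And>k. k < n \<Longrightarrow> \<bar>q k - p k\<bar> \<le> \<epsilon>) \<Longrightarrow> q \<in> V"
    using open_fun_boxE[OF V] by blast
  define \<eta> where "\<eta> = min (\<epsilon> / 2) ((1 - exp (- a) - s) / (2 * (real n + 1)))"
  have \<eta>: "\<eta> > 0" "2 * \<eta> \<le> \<epsilon>" using \<epsilon> s by (auto simp: \<eta>_def)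
  have "\<eta> * (2 * (real n + 1)) \<le> 1 - exp (- a) - s"
  proof -
    have "\<eta> \<le> (1 - exp (- a) - s) / (2 * (real n + 1))" by (simp add: \<eta>_def)
    then show ?thesis by (simp add: pos_le_divide_eq)
  qed
  then have \<eta>n: "s + real n * \<eta> < 1 - exp (- a)" using \<eta> s by (simp add: algebra_simps)
  define q where "q k = p k + \<eta>" for k
  have q_sum: "(\<Sum>i<k. q i) < 1 - exp (- a)" if "k \<le> n" for k
  proof -
    have "(\<Sum>i<k. q i) = (\<Sum>i<k. p i) + real k * \<eta>" by (simp add: q_def sum.distrib)
    also have "(\<Sum>i<k. p i) \<le> s" unfolding s_def using s p0 by (intro sum_le_suminf) auto
    also have "real k * \<eta> \<le> real n * \<eta>" using that \<eta> by (intro mult_right_mono) auto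
    finally show ?thesis using \<eta>n by linarith
  qed
  then have q_sum1: "(\<Sum>i<k. q i) < 1" if "k \<le> n" for k
    using that exp_gt_zero[of "- a"] by (smt (verit))
  define w where "w k = q k / (1 - (\<Sum>i<k. q i))" for k
  have q_pos: "q k > 0" for k using p0[of k] \<eta> by (simp add: q_def)
  have w: "0 < w k" "w k < 1" if "k < n" for k
    using q_pos[of k] q_sum1[of k] q_sum1[of "Suc k"] that by (auto simp: w_def divide_simps)
  have w_prod: "(\<Prod>i<n. 1 - w i) = 1 - (\<Sum>i<n. q i)"
    unfolding w_def using q_sum1 by (intro stick_breaking_inverse(1)[of n]) auto
  have w_stick: "stick_breaking w k = q k" if "k < n" for k
    unfolding w_def using q_sum1 that by (intro stick_breaking_inverse(2)[of n]) auto
  define \<gamma> where "\<gamma> = Min (insert (\<eta> / (real n + 1)) ((\<lambda>k. w k / 2) ` {..<n}))"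
  have \<gamma>: "\<gamma> > 0" unfolding \<gamma>_def using \<eta> w by (subst Min_gr_iff) auto
  have \<gamma>w: "\<gamma> < w k" if "k < n" for k
  proof -
    have "\<gamma> \<le> w k / 2" unfolding \<gamma>_def using that by (intro Min_le) auto
    then show ?thesis using w[OF that] by simp
  qed
  have \<gamma>n: "real n * \<gamma> \<le> \<eta>"
  proof -
    have "\<gamma> \<le> \<eta> / (real n + 1)" unfolding \<gamma>_def by (intro Min_le) auto
    then have "\<gamma> * (real n + 1) \<le> \<eta>" by (simp add: pos_le_divide_eq)
    then show ?thesis using \<gamma> by (simp add: algebra_simps)
  qed
  have good: "descending_rearrangement (stick_breaking u) \<in> V"
    if u: "u \<in> break_fractions" and near: "\<forall>k<n. w k - \<gamma> < u k \<and> u k < w k"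
      and small: "\<forall>i\<ge>n. stick_breaking u i \<le> \<epsilon>" for u
  proof (rule box, rule ranked_near[OF u p])
    fix k assume "k < n"
    have "\<bar>stick_breaking u k - stick_breaking w k\<bar> \<le> (\<Sum>i\<le>k. \<bar>u i - w i\<bar>)"
      using u w \<open>k < n\<close> by (intro stick_breaking_lipschitz) (auto simp: break_fractions_def less_imp_le)
    also have "\<dots> \<le> (\<Sum>i\<le>k. \<gamma>)"
    proof (rule sum_mono)
      fix i assume "i \<in> {..k}"
      then have "w i - \<gamma> < u i \<and> u i < w i" using near \<open>k < n\<close> by simp
      then show "\<bar>u i - w i\<bar> \<le> \<gamma>" using \<gamma> by (simp add: abs_le_iff)
    qed
    also have "\<dots> \<le> real n * \<gamma>" using \<open>k < n\<close> \<gamma> by (simp add: mult_right_mono)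
    finally have "\<bar>stick_breaking u k - stick_breaking w k\<bar> \<le> \<eta>" using \<gamma>n by simp
    then show "\<bar>stick_breaking u k - p k\<bar> \<le> \<epsilon>"
      unfolding w_stick[OF \<open>k < n\<close>] using \<eta> by (simp add: q_def abs_le_iff)
  qed (use small in auto)
  define y where "y = 1 - (\<Sum>i<n. q i)"
  have y: "exp (- a) < y" "0 < y" using q_sum[of n] exp_gt_zero[of "- a"] by (auto simp: y_def simp del: exp_gt_zero)
  have "ln y > - a" using y ln_less_cancel_iff[of "exp (- a)" y] by simp
  then have "\<forall>\<^sub>F \<theta> in at_top. (2 / \<gamma> ^ n) * exp (- (a * \<theta>)) \<le> exp (- ((- ln y) * \<theta>))"
    by (intro eventually_const_mult_exp_le) simp
  moreover have "\<forall>\<^sub>F \<theta> in at_top. 1 / (\<epsilon>\<^sup>2 * (\<theta> + 1)) \<le> 1 / 2"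
  proof -
    have "((\<lambda>\<theta>. 1 / (\<epsilon>\<^sup>2 * (\<theta> + 1))) \<longlongrightarrow> 0) at_top" using \<epsilon> by real_asymp
    then have "\<forall>\<^sub>F \<theta> in at_top. 1 / (\<epsilon>\<^sup>2 * (\<theta> + 1)) < 1 / 2" by (rule order_tendstoD) simp
    then show ?thesis by eventually_elim simp
  qed
  ultimately show ?thesis using eventually_ge_at_top[of 1]
  proof eventually_elim
    case (elim \<theta>)
    interpret prob_space "sticks \<theta>" using elim by (intro prob_space_sticks) simp
    let ?U = "{u\<in>space (sticks \<theta>). descending_rearrangement (stick_breaking u) \<in> V}"
    have mU: "?U \<in> sets (sticks \<theta>)"
    proof -
      have "(\<lambda>u. descending_rearrangement (stick_breaking u)) \<in> borel_measurable (sticks \<theta>)"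
        using measurable_ranked[of \<theta>] by (simp add: measurable_restrict_space2_iff)
      from measurable_sets[OF this, of V] V(1) show ?thesis
        by (simp add: vimage_def Int_def conj_commute borel_open)
    qed
    have b: "\<gamma> ^ n * y powr \<theta> \<le> (\<Prod>k<n. measure (beta_one \<theta>) {w k - \<gamma><..<w k})"
    proof -
      have "y powr \<theta> = (\<Prod>k<n. (1 - w k) powr \<theta>)"
        unfolding y_def w_prod[symmetric] by (rule prod_powr_distrib)
      then have "\<gamma> ^ n * y powr \<theta> = (\<Prod>k<n. (w k - (w k - \<gamma>)) * (1 - w k) powr \<theta>)"
        by (simp add: prod.distrib)
      also have "\<dots> \<le> (\<Prod>k<n. measure (beta_one \<theta>) {w k - \<gamma><..<w k})"
        using elim \<gamma> \<gamma>w w by (intro prod_mono conjI beta_one_interval_ge) (auto simp: less_imp_le)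
      finally show ?thesis .
    qed
    have "y powr \<theta> = exp (- ((- ln y) * \<theta>))"
      using y by (simp add: powr_def mult.commute)
    then have "\<gamma> ^ n / 2 * (2 / \<gamma> ^ n * exp (- (a * \<theta>))) \<le> \<gamma> ^ n / 2 * y powr \<theta>"
      using elim(1) \<gamma> by (intro mult_left_mono) auto
    then have "exp (- (a * \<theta>)) \<le> 1 / 2 * (\<gamma> ^ n * y powr \<theta>)"
      using \<gamma> by simp
    also have "\<dots> \<le> (1 - 1 / (\<epsilon>\<^sup>2 * (\<theta> + 1))) * (\<Prod>k<n. measure (beta_one \<theta>) {w k - \<gamma><..<w k})"
      using elim(2) b y \<gamma> by (intro mult_mono) auto
    also have "\<dots> \<le> prob {u\<in>space (sticks \<theta>). (\<forall>k<n. w k - \<gamma> < u k \<and> u k < w k) \<and>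
        (\<forall>i\<ge>n. stick_breaking u i \<le> \<epsilon>)}"
      using elim \<gamma> \<gamma>w w \<epsilon> by (intro box_prob_ge) auto
    also have "\<dots> \<le> prob ?U"
      using good mU by (intro finite_measure_mono) (auto simp: space_sticks)
    also have "\<dots> = measure (PD \<theta>) (V \<inter> nabla_bar)"
      using measure_PD[OF V(1)] by simp
    finally show ?case .
  qed
qed

theorem PD_local_rate: "local_rate nabla_bar (\<lambda>\<theta>. measure (PD \<theta>)) rate_S"
  unfolding local_rate_def using PD_local_upper PD_local_lower by blast

text \<open>
  \<open>rate_S\<close> is nonnegative and vanishes at the zero sequence.
\<close>
lemma rate_Sc_0: "p \<in> nabla_bar \<Longrightarrow> rate_Sc 0 H p = rate_S p"
proof -
  assume p: "p \<in> nabla_bar"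
  have nn: "0 \<le> rate_S q" if "q \<in> nabla_bar" for q
    using local_rate_nonneg[OF prob_space_PD PD_local_rate that] .
  have z: "(\<lambda>_. 0) \<in> nabla_bar" "rate_S (\<lambda>_. 0) = 0"
    by (auto simp: nabla_bar_def rate_S_def decseq_def zero_ereal_def)
  have "(SUP q\<in>nabla_bar. ereal (0 * H q) - rate_S q) = 0"
  proof (rule antisym)
    show "(SUP q\<in>nabla_bar. ereal (0 * H q) - rate_S q) \<le> 0"
      using nn by (intro SUP_least) (simp flip: zero_ereal_def)
    show "0 \<le> (SUP q\<in>nabla_bar. ereal (0 * H q) - rate_S q)"
      using z by (intro SUP_upper2[OF z(1)]) (simp flip: zero_ereal_def)
  qed
  then show ?thesis using nn[OF p] unfolding rate_Sc_def by (simp flip: zero_ereal_def)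
qed

theorem theorem5p2:
  fixes \<alpha> :: "real \<Rightarrow> real" and c :: real and H :: "(nat \<Rightarrow> real) \<Rightarrow> real"
  assumes "((\<lambda>\<theta>. \<alpha> \<theta> / \<theta>) \<longlongrightarrow> 0) at_top \<or> (c > 0 \<and> ((\<lambda>\<theta>. \<alpha> \<theta> / \<theta>) \<longlongrightarrow> c) at_top)"
    and "continuous_on nabla_bar H"
    and "bounded (H ` nabla_bar)"
  shows "LDP nabla_bar (tilted_PD \<alpha> H)
           (\<lambda>p. if ((\<lambda>\<theta>. \<alpha> \<theta> / \<theta>) \<longlongrightarrow> 0) at_top then rate_S p else rate_Sc c H p)"
proof -
  let ?I = "\<lambda>p. if ((\<lambda>\<theta>. \<alpha> \<theta> / \<theta>) \<longlongrightarrow> 0) at_top then rate_S p else rate_Sc c H p"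
  have LDP: "LDP nabla_bar (tilted_PD \<alpha> H) ?I"
    if h: "((\<lambda>\<theta>. \<alpha> \<theta> / \<theta>) \<longlongrightarrow> h) at_top" and I: "\<And>p. p \<in> nabla_bar \<Longrightarrow> ?I p = rate_Sc h H p" for h
  proof -
    interpret tilting nabla_bar PD rate_S H \<alpha> h
      by (intro tilting.intro compact_nabla_bar prob_space_PD sets_PD PD_local_rate assms(2,3) h)
    have "(\<lambda>_. 0) \<in> nabla_bar" "rate_S (\<lambda>_. 0) < \<infinity>"
      by (auto simp: nabla_bar_def rate_S_def decseq_def)
    then have fin: "\<exists>p\<in>nabla_bar. rate_S p < \<infinity>" by blast
    show ?thesis
      unfolding tilted_PD_def[abs_def]
      by (rule LDP_tilted[OF fin]) (rule trans[OF I rate_Sc_def])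
  qed
  show ?thesis
  proof (cases "((\<lambda>\<theta>. \<alpha> \<theta> / \<theta>) \<longlongrightarrow> 0) at_top")
    case True
    then show ?thesis by (intro LDP[of 0]) (simp_all add: rate_Sc_0)
  next
    case False
    then have "((\<lambda>\<theta>. \<alpha> \<theta> / \<theta>) \<longlongrightarrow> c) at_top" using assms(1) by blast
    then show ?thesis using False by (intro LDP[of c]) simp_all
  qed
qed

end
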